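(* Let $\alpha$, $\zeta_*$, $\tau$, $\theta$ be as below, and extend $\tau,\theta$ from $[0,\pi/2]$ to $[0,\pi]$ by $\tau(\pi/2+\sigma)=\tau(\pi/2-\sigma)$, $\theta(\pi/2+\sigma)=-\theta(\pi/2-\sigma)$ for $\sigma\in[0,\pi/2]$. Then $\tau$ and $\theta$ are real-analytic on $(0,\pi)$.
   Context: $L^2=L^2(0,\pi/2)$. The kernel is $K(s,\sigma)=\log\Big|\frac{\sin(s+\sigma)}{\sin(s-\sigma)}\Big|$ and $(Hw)(\sigma)=\frac1\pi\int_0^{\pi/2}K(s,\sigma)\,w(s)\,ds$. For $\alpha>0$, $\varPhi(\zeta)(\sigma)=\frac{3}{\alpha\pi}\,\frac{\sin(\sigma+\frac13(H\zeta)(\sigma))\cot\sigma}{\exp\int_0^\sigma\zeta\,ds}$, $\sigma\in(0,\pi/2]$. Let $\alpha\geqslant\frac2\pi\big(1+\frac{1}{3\sqrt\pi}\big)$, let $\zeta_*\in L^2$ be a non-negative solution of $\zeta_*=\varPhi(\zeta_* )$ with $\|\zeta_*\|\leqslant\frac{9\sqrt\pi}2$ and $0\le\sigma+\frac13(H\zeta_* )(\sigma)\le\pi$, and set $\theta=\frac13H\zeta_*$, $\tau(\sigma)=\log\frac\pi2+\frac13\int_0^\sigma\zeta_*(s)\,ds$ on $[0,\pi/2]$. Equivalently, $\tau$ and $\theta$ satisfy on $(0,\pi/2)$ the equation $e^{3\tau(\sigma)}\tau'(\sigma)=\frac{\pi^2}{8\alpha}\sin(\sigma+\theta(\sigma))\cot\sigma$,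 and (extended to the whole circle by the symmetries $\tau(-\sigma)=\tau(\sigma)$, $\theta(-\sigma)=-\theta(\sigma)$, $\tau(\sigma+\pi)=\tau(\sigma)$, $\theta(\sigma+\pi)=\theta(\sigma)$ in addition to the reflection about $\pi/2$) are the boundary traces of a harmonic function and its harmonic conjugate in the unit disk. *)

theory Defs
  imports "HOL-Analysis.Analysis"
begin

definition kerK :: "real \<Rightarrow> real \<Rightarrow> real" where
  "kerK s \<sigma> = ln \<bar>sin (s + \<sigma>) / sin (s - \<sigma>)\<bar>"

definition opH :: "(real \<Rightarrow> real) \<Rightarrow> real \<Rightarrow> real" where
  "opH w \<sigma> = (1 / pi) * (LINT s:{0<..<pi/2}|lborel. kerK s \<sigma> * w s)"

text \<open>The operator Phi of the paper (for alpha > 0), on sigma in (0, pi/2].\<close>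
definition opPhi :: "real \<Rightarrow> (real \<Rightarrow> real) \<Rightarrow> real \<Rightarrow> real" where
  "opPhi \<alpha> \<zeta> \<sigma> = (3 / (\<alpha> * pi)) * (sin (\<sigma> + (1/3) * opH \<zeta> \<sigma>) * cot \<sigma>)
      / exp (LINT s:{0..\<sigma>}|lborel. \<zeta> s)"

definition real_analytic_on :: "(real \<Rightarrow> real) \<Rightarrow> real set \<Rightarrow> bool" where
  "real_analytic_on f U \<longleftrightarrow>
     (\<forall>x\<in>U. \<exists>r>0. \<exists>a::nat \<Rightarrow> real.
        \<forall>y. \<bar>y - x\<bar> < r \<longrightarrow> (\<lambda>n. a n * (y - x) ^ n) sums f y)"

end

theory Submission
  imports Defs "HOL-Complex_Analysis.Complex_Analysis"
begin

text \<open>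
  With \<open>w = \<tau> - log (\<pi>/2)\<close>, the function \<open>\<theta> + i w\<close> on \<open>(0, \<pi>)\<close> is the boundary trace of a
  function \<open>G\<close> that is holomorphic in the upper half plane and continuous up to the real axis:
  \<open>G\<close> is a power series in \<open>exp (2 i z)\<close> whose coefficients \<open>b\<^sub>n / n\<close>, with \<open>b\<^sub>n\<close> the sine
  coefficients of \<open>\<zeta>\<close>, are absolutely summable by Bessel's inequality. Substituting
  \<open>\<theta> = G - i w\<close> into the boundary equation turns it into the ordinary differential equation
  \<open>w' = c cot z sin (z + G(z) - i w) exp (- 3 w)\<close>, whose right-hand side is holomorphic in \<open>z\<close>
  above the real axis and continuous up to it. Picard iteration solves it on a closed upper half
  disc about any point of \<open>(0, \<pi>)\<close>; by uniqueness the solution restricts to the real \<open>w\<close>.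
  Schwarz reflection of this solution \<open>T\<close> and of \<open>G - i T\<close>, both real on the real axis,
  gives the analyticity of \<open>\<tau>\<close> and \<open>\<theta>\<close>.
\<close>

section \<open>Differential equations on half discs\<close>

text \<open>The iterates stay continuous on \<open>S\<close> and holomorphic in its interior, and on
  a convex set every such function has a primitive that is differentiable within \<open>S\<close>,
  boundary points included. \<open>M * r \<le> R\<close> keeps the iterates in the ball, and
  \<open>L * r \<le> 1/2\<close> makes each step halve distances.\<close>

lemma Picard_iteration_convex:
  fixes S :: "complex set" and f :: "complex \<Rightarrow> complex \<Rightarrow> complex"
  assumes S: "convex S" "z0 \<in> S" and r: "\<And>z. z \<in> S \<Longrightarrow> norm (z - z0) \<le> r"
    and R: "R \<ge> 0"
    and bound: "\<And>z w. z \<in> S \<Longrightarrow> w \<in> cball w0 R \<Longrightarrow> norm (f z w) \<le> M"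
    and lip: "\<And>z w w'. z \<in> S \<Longrightarrow> w \<in> cball w0 R \<Longrightarrow> w' \<in> cball w0 R \<Longrightarrow>
                norm (f z w - f z w') \<le> L * norm (w - w')"
    and cont: "\<And>g. continuous_on S g \<Longrightarrow> continuous_on S (\<lambda>z. f z (g z))"
    and hol: "\<And>g. g holomorphic_on interior S \<Longrightarrow> (\<lambda>z. f z (g z)) holomorphic_on interior S"
    and Mr: "M * r \<le> R" and Lr: "L * r \<le> 1/2" and L: "L \<ge> 0"
  shows "\<exists>T. T z0 = w0 \<and> (\<forall>z\<in>S. T z \<in> cball w0 R \<and> (T has_field_derivative f z (T z)) (at z within S))"
proof -
  define good where "good g \<longleftrightarrow> continuous_on S g \<and> g holomorphic_on interior S \<and> g ` S \<subseteq> cball w0 R"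
    for g :: "complex \<Rightarrow> complex"
  have r0: "r \<ge> 0" using r[OF S(2)] by simp
  have M0: "M \<ge> 0" using bound[OF S(2), of w0] R norm_ge_zero order_trans by (metis centre_in_cball)
  have step: "\<exists>h. good h \<and> h z0 = w0 \<and> (\<forall>z\<in>S. (h has_field_derivative f z (g z)) (at z within S))"
    if g: "good g" for g
  proof -
    have fg: "continuous_on S (\<lambda>z. f z (g z))" "(\<lambda>z. f z (g z)) holomorphic_on interior S"
      using cont hol g by (auto simp: good_def)
    obtain h where h: "\<And>z. z \<in> S \<Longrightarrow> (h has_field_derivative f z (g z)) (at z within S)"
      using holomorphic_convex_primitive[OF S(1), of "{}" "\<lambda>z. f z (g z)"] fg
      by (metis (no_types, lifting) Diff_empty finite.emptyI holomorphic_on_imp_differentiable_at open_interior)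
    define k where "k z = h z - h z0 + w0" for z
    have k: "(k has_field_derivative f z (g z)) (at z within S)" if "z \<in> S" for z
      unfolding k_def by (auto intro!: derivative_eq_intros h that)
    have "continuous_on S k"
      using k by (meson DERIV_continuous continuous_on_eq_continuous_within)
    moreover have "k holomorphic_on interior S"
      unfolding holomorphic_on_def
      by (meson k field_differentiable_def has_field_derivative_subset interior_subset subsetD)
    moreover have "k z \<in> cball w0 R" if z: "z \<in> S" for z
    proof -
      have "norm (k z - k z0) \<le> M * norm (z - z0)"
        by (rule field_differentiable_bound[OF S(1) k]) (use z S g bound in \<open>auto simp: good_def\<close>)
      also have "\<dots> \<le> M * r" using r[OF z] M0 by (simp add: mult_left_mono)
      finally show ?thesis using Mr by (simp add: k_def dist_norm norm_minus_commute)
    qed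
    ultimately show ?thesis using k by (intro exI[of _ k]) (auto simp: good_def k_def)
  qed
  define P where "P g = (SOME h. good h \<and> h z0 = w0 \<and> (\<forall>z\<in>S. (h has_field_derivative f z (g z)) (at z within S)))" for g
  have P: "good (P g)" "P g z0 = w0" "\<And>z. z \<in> S \<Longrightarrow> (P g has_field_derivative f z (g z)) (at z within S)"
    if "good g" for g
    using someI_ex[OF step[OF that]] by (auto simp: P_def)
  have contr: "norm (P g z - P h z) \<le> B / 2"
    if gh: "good g" "good h" and B: "\<And>z. z \<in> S \<Longrightarrow> norm (g z - h z) \<le> B" and z: "z \<in> S" for g h B z
  proof -
    have B0: "B \<ge> 0" using B[OF z] norm_ge_zero order_trans by blast
    \<comment> \<open>Both images take the value \<open>w0\<close> at \<open>z0\<close>, so the mean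
      value inequality on the convex set reduces their distance to a bound on the difference of
      their derivatives.\<close>
    have "norm ((\<lambda>z. P g z - P h z) z - (\<lambda>z. P g z - P h z) z0) \<le> (L * B) * norm (z - z0)"
    proof (rule field_differentiable_bound[OF S(1)])
      show "((\<lambda>z. P g z - P h z) has_field_derivative f u (g u) - f u (h u)) (at u within S)" if "u \<in> S" for u
        by (intro derivative_intros P gh that)
      show "norm (f u (g u) - f u (h u)) \<le> L * B" if u: "u \<in> S" for u
        using lip[OF u, of "g u" "h u"] gh u mult_left_mono[OF B[OF u] L] by (force simp: good_def)
    qed (use z S in auto)
    also have "\<dots> \<le> (L * B) * r" using r[OF z] L B0 by (simp add: mult_left_mono)
    also have "\<dots> \<le> B / 2" using mult_right_mono[OF Lr B0] by (simp add: algebra_simps)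
    finally show ?thesis using P(2) gh by simp
  qed
  define T where "T n = (P ^^ n) (\<lambda>_. w0)" for n
  have good0: "good (\<lambda>_. w0)" using R by (auto simp: good_def)
  have TS: "T (Suc n) = P (T n)" for n by (simp add: T_def)
  have goodT: "good (T n)" for n
    by (induction n) (use good0 P in \<open>auto simp: T_def\<close>)
  have dT: "norm (T (Suc n) z - T n z) \<le> R * (1/2) ^ n" if "z \<in> S" for n z
    using that
  proof (induction n arbitrary: z)
    case 0
    have "T 1 z \<in> cball w0 R" using goodT[of 1] 0 by (auto simp: good_def)
    then show ?case by (simp add: T_def dist_norm norm_minus_commute)
  next
    case (Suc n)
    have "norm (P (T (Suc n)) z - P (T n) z) \<le> (R * (1/2)^n) / 2"
      by (rule contr[OF goodT goodT Suc.IH Suc.prems])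
    then show ?case by (simp add: TS)
  qed
  define U where "U z = w0 + (\<Sum>i. T (Suc i) z - T i z)" for z
  have tele: "(\<Sum>i<n. T (Suc i) z - T i z) = T n z - w0" for n z
    by (induction n) (auto simp: T_def)
  have "uniform_limit S (\<lambda>n z. \<Sum>i<n. T (Suc i) z - T i z) (\<lambda>z. \<Sum>i. T (Suc i) z - T i z) sequentially"
    by (rule Weierstrass_m_test[where M = "\<lambda>n. R * (1/2) ^ n"])
      (use dT in \<open>auto intro!: summable_mult summable_geometric\<close>)
  then have ul: "uniform_limit S T U sequentially"
    unfolding tele U_def by (auto simp: uniform_limit_iff dist_norm algebra_simps)
  have TU: "(\<lambda>n. T n z) \<longlonglongrightarrow> U z" if "z \<in> S" for z
    using tendsto_uniform_limitI[OF ul that] .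
  have Uball: "U z \<in> cball w0 R" if "z \<in> S" for z
  proof (rule Lim_in_closed_set[OF closed_cball _ _ TU[OF that]])
    show "\<forall>\<^sub>F n in sequentially. T n z \<in> cball w0 R"
      using goodT that unfolding good_def by (intro always_eventually) blast
  qed auto
  \<comment> \<open>The derivative of \<open>T (Suc n)\<close> is \<open>f x (T n x)\<close>, which
    converges uniformly to \<open>f x (U x)\<close> by the Lipschitz bound. Limit and derivative may
    therefore be exchanged, also at boundary points of \<open>S\<close>.\<close>
  have "\<exists>g. \<forall>x\<in>S. ((\<lambda>n. T (Suc n) x) \<longlonglongrightarrow> g x) \<and>
              (g has_field_derivative f x (U x)) (at x within S)"
  proof (rule has_complex_derivative_sequence[OF S(1)])
    show "(T (Suc n) has_field_derivative f x (T n x)) (at x within S)" if "x \<in> S" for n x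
      unfolding TS by (rule P(3)[OF goodT that])
    show "\<exists>N. \<forall>n x. n \<ge> N \<longrightarrow> x \<in> S \<longrightarrow> norm (f x (T n x) - f x (U x)) \<le> e" if e: "e > 0" for e
    proof -
      have "e / (L + 1) > 0" using e L by simp
      then obtain N where N: "\<And>n x. n \<ge> N \<Longrightarrow> x \<in> S \<Longrightarrow> dist (T n x) (U x) < e / (L + 1)"
        using ul unfolding uniform_limit_iff eventually_sequentially by blast
      have "norm (f x (T n x) - f x (U x)) \<le> e" if "n \<ge> N" and x: "x \<in> S" for n x
      proof -
        have "T n x \<in> cball w0 R" using goodT x unfolding good_def by blast
        then have "norm (f x (T n x) - f x (U x)) \<le> L * norm (T n x - U x)"
          by (rule lip[OF x _ Uball[OF x]])
        also have "\<dots> \<le> L * (e / (L + 1))"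
          using N[OF that] L by (intro mult_left_mono) (auto simp: dist_norm)
        also have "\<dots> \<le> e" using L e by (simp add: field_simps)
        finally show ?thesis .
      qed
      then show ?thesis by blast
    qed
    show "\<exists>x l. x \<in> S \<and> (\<lambda>n. T (Suc n) x) \<longlonglongrightarrow> l"
      using LIMSEQ_Suc[OF TU[OF S(2)]] S(2) by blast
  qed
  then obtain g where g: "\<And>x. x \<in> S \<Longrightarrow> (\<lambda>n. T (Suc n) x) \<longlonglongrightarrow> g x"
      "\<And>x. x \<in> S \<Longrightarrow> (g has_field_derivative f x (U x)) (at x within S)" by blast
  have gU: "g x = U x" if "x \<in> S" for x
    using g(1)[OF that] LIMSEQ_Suc[OF TU[OF that]] LIMSEQ_unique by blast
  have "T n z0 = w0" for n
    by (cases n) (auto simp: TS P(2)[OF goodT], simp add: T_def)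
  then have "g z0 = w0" using g(1)[OF S(2)] by (simp add: LIMSEQ_const_iff)
  then show ?thesis using g(2) gU Uball by (intro exI[of _ g]) auto
qed

text \<open>Schwarz reflection extends \<open>f\<close> holomorphically to the whole disc, where the
  Taylor series at \<open>x\<close> converges with the same radius. At real points the values and
  the powers of \<open>y - x\<close> are real, so real parts of the Taylor coefficients suffice and
  their reality need not be shown.\<close>

lemma real_power_series_by_reflection:
  fixes x r :: real and f :: "complex \<Rightarrow> complex" and u :: "real \<Rightarrow> real"
  assumes cont: "continuous_on (ball (of_real x) r \<inter> {z. 0 \<le> Im z}) f"
    and hol: "f holomorphic_on (ball (of_real x) r \<inter> {z. 0 < Im z})"
    and real: "\<And>y. \<bar>y - x\<bar> < r \<Longrightarrow> f (of_real y) = of_real (u y)"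
  shows "\<exists>a :: nat \<Rightarrow> real. \<forall>y. \<bar>y - x\<bar> < r \<longrightarrow> (\<lambda>n. a n * (y - x) ^ n) sums u y"
proof -
  define g where "g z = (if 0 \<le> Im z then f z else cnj (f (cnj z)))" for z
  have dr: "dist (complex_of_real x) (of_real y) = \<bar>y - x\<bar>" for y
    by (metis dist_of_real dist_real_def dist_commute)
  have "g holomorphic_on ball (of_real x) r"
    unfolding g_def
  proof (rule Schwarz_reflection)
    have "dist (of_real x) (cnj z) = dist (of_real x) z" for z
      by (metis complex_cnj_complex_of_real complex_cnj_diff complex_mod_cnj dist_norm)
    then show "cnj ` ball (of_real x) r \<subseteq> ball (of_real x) r" by auto
    show "f z \<in> \<real>" if zr: "z \<in> ball (of_real x) r" "z \<in> \<real>" for z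
    proof -
      obtain y where y: "z = of_real y" using zr(2) by (auto elim: Reals_cases)
      then have "\<bar>y - x\<bar> < r" using zr(1) by (auto simp: dist_real_def)
      then show ?thesis using real y by simp
    qed
  qed (use cont hol in auto)
  note ps = holomorphic_power_series[OF this]
  define a where "a n = Re ((deriv ^^ n) g (of_real x) / fact n)" for n
  have "(\<lambda>n. a n * (y - x) ^ n) sums u y" if y: "\<bar>y - x\<bar> < r" for y
  proof -
    have "(\<lambda>n. (deriv ^^ n) g (of_real x) / fact n * (of_real y - of_real x) ^ n) sums g (of_real y)"
      using y by (intro ps) (auto simp: dist_real_def abs_minus_commute)
    then have "(\<lambda>n. Re ((deriv ^^ n) g (of_real x) / fact n * (of_real y - of_real x) ^ n)) sums Re (g (of_real y))"
      by (simp add: sums_complex_iff)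
    moreover have "Re (g (of_real y)) = u y" using real[OF y] by (simp add: g_def)
    moreover have "Re (c * (of_real y - of_real x) ^ n) = Re c * (y - x) ^ n" for c n
      by (simp flip: of_real_diff of_real_power)
    ultimately show ?thesis by (simp only: a_def)
  qed
  then show ?thesis by blast
qed


lemma interior_upper_half_disc:
  "interior (cball c r \<inter> {z. 0 \<le> Im z}) = ball c r \<inter> {z. 0 < Im z}"
proof -
  have "interior {z. Im z \<ge> 0} = {z. Im z > 0}"
    using interior_halfspace_ge[of \<i> 0] by (simp add: inner_complex_def)
  then show ?thesis by (simp add: interior_Int)
qed

text \<open>Compactness of the half disc times the unit ball about \<open>u x\<close> supplies the
  bound and the Lipschitz constant for Picard iteration. The complex solution must then agree with
  \<open>u\<close> on the real diameter, because both solve the same equation there with the same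
  value at \<open>x\<close>.\<close>

lemma ODE_solution_extends_to_half_disc:
  fixes x r0 :: real and f f' :: "complex \<Rightarrow> complex \<Rightarrow> complex" and u :: "real \<Rightarrow> real"
  assumes r0: "r0 > 0"
    and cont: "continuous_on ((cball (of_real x) r0 \<inter> {z. 0 \<le> Im z}) \<times> UNIV) (\<lambda>(z, w). f z w)"
    and cont': "continuous_on ((cball (of_real x) r0 \<inter> {z. 0 \<le> Im z}) \<times> UNIV) (\<lambda>(z, w). f' z w)"
    and deriv: "\<And>z w. z \<in> cball (of_real x) r0 \<inter> {z. 0 \<le> Im z} \<Longrightarrow>
                  (f z has_field_derivative f' z w) (at w)"
    and hol: "\<And>g U. U \<subseteq> ball (of_real x) r0 \<inter> {z. 0 < Im z} \<Longrightarrow> g holomorphic_on U \<Longrightarrow>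
                  (\<lambda>z. f z (g z)) holomorphic_on U"
    and ode: "\<And>y. \<bar>y - x\<bar> \<le> r0 \<Longrightarrow>
                \<exists>D. (u has_real_derivative D) (at y) \<and> of_real D = f (of_real y) (of_real (u y))"
  obtains r T where "0 < r" "r \<le> r0"
    "continuous_on (ball (of_real x) r \<inter> {z. 0 \<le> Im z}) T"
    "T holomorphic_on (ball (of_real x) r \<inter> {z. 0 < Im z})"
    "\<And>y. \<bar>y - x\<bar> < r \<Longrightarrow> T (of_real y) = of_real (u y)"
proof -
  define S where "S r = cball (complex_of_real x) r \<inter> {z. 0 \<le> Im z}" for r
  define w0 where "w0 = complex_of_real (u x)"
  have convS: "convex (S r)" for r
    unfolding S_def by (intro convex_Int convex_cball convex_halfspace_Im_ge)
  have compS: "compact (S r)" for r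
    unfolding S_def by (intro compact_Int_closed compact_cball closed_halfspace_Im_ge)
  have Ssub: "S r \<subseteq> S r0" if "r \<le> r0" for r using that by (auto simp: S_def)
  have dr: "dist (complex_of_real x) (of_real y) = \<bar>y - x\<bar>" for y
    by (metis dist_of_real dist_real_def dist_commute)
  have comp: "compact (S r0 \<times> cball w0 1)" using compS by (intro compact_Times) auto
  have "bounded ((\<lambda>(z, w). f z w) ` (S r0 \<times> cball w0 1))"
    by (intro compact_imp_bounded compact_continuous_image[OF _ comp] continuous_on_subset[OF cont])
       (auto simp: S_def)
  then obtain M where M: "M > 0" "\<And>z w. z \<in> S r0 \<Longrightarrow> w \<in> cball w0 1 \<Longrightarrow> norm (f z w) \<le> M"
    unfolding bounded_pos by force
  have "bounded ((\<lambda>(z, w). f' z w) ` (S r0 \<times> cball w0 1))"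
    by (intro compact_imp_bounded compact_continuous_image[OF _ comp] continuous_on_subset[OF cont'])
       (auto simp: S_def)
  then obtain L where L: "L > 0" "\<And>z w. z \<in> S r0 \<Longrightarrow> w \<in> cball w0 1 \<Longrightarrow> norm (f' z w) \<le> L"
    unfolding bounded_pos by force
  have lip: "norm (f z w - f z w') \<le> L * norm (w - w')"
    if "z \<in> S r0" "w \<in> cball w0 1" "w' \<in> cball w0 1" for z w w'
    by (rule field_differentiable_bound[OF convex_cball _ L(2)])
       (use that deriv in \<open>auto simp: S_def intro: has_field_derivative_at_within\<close>)
  have "isCont u x" using ode[of x] r0 DERIV_isCont by auto
  then obtain d where d: "d > 0" "\<And>y. \<bar>y - x\<bar> < d \<Longrightarrow> \<bar>u y - u x\<bar> < 1"
    unfolding continuous_at_eps_delta by (metis dist_real_def zero_less_one)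
  \<comment> \<open>The four bounds serve, in order: the domain of \<open>f\<close>, the unit ball
    about \<open>u x\<close> that has to contain the values of \<open>u\<close>, the invariance of
    that ball under the iteration, and the contraction.\<close>
  define r where "r = min (min r0 (d / 2)) (min (1 / M) (1 / (2 * L)))"
  have r: "r > 0" "r \<le> r0" "r < d" "M * r \<le> 1" "L * r \<le> 1/2"
  proof -
    show "r > 0" "r \<le> r0" using r0 d M L by (auto simp: r_def)
    have "r \<le> d / 2" by (auto simp: r_def)
    then show "r < d" using d by simp
    have "r \<le> 1 / M" by (auto simp: r_def)
    then show "M * r \<le> 1" using M by (simp add: field_simps)
    have "r \<le> 1 / (2 * L)" by (auto simp: r_def)
    then show "L * r \<le> 1/2" using L by (simp add: field_simps)
  qed
  have int: "interior (S r) = ball (of_real x) r \<inter> {z. 0 < Im z}"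
    unfolding S_def by (rule interior_upper_half_disc)
  have "\<exists>T. T (of_real x) = w0 \<and> (\<forall>z\<in>S r. T z \<in> cball w0 1 \<and>
          (T has_field_derivative f z (T z)) (at z within S r))"
  proof (rule Picard_iteration_convex[where M = M and L = L and r = r])
    show "continuous_on (S r) (\<lambda>z. f z (g z))" if "continuous_on (S r) g" for g
    proof -
      have "continuous_on (S r) (\<lambda>z. (z, g z))" by (intro continuous_intros that)
      from continuous_on_compose2[OF cont this] Ssub[OF r(2)] show ?thesis by (auto simp: S_def)
    qed
    show "(\<lambda>z. f z (g z)) holomorphic_on interior (S r)" if "g holomorphic_on interior (S r)" for g
      by (rule hol) (use that r(2) in \<open>auto simp: int\<close>)
  qed (use r L M lip Ssub[OF r(2)] convS in \<open>auto simp: S_def dist_norm norm_minus_commute\<close>)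
  then obtain T where T: "T (of_real x) = w0" "\<And>z. z \<in> S r \<Longrightarrow> T z \<in> cball w0 1"
    "\<And>z. z \<in> S r \<Longrightarrow> (T has_field_derivative f z (T z)) (at z within S r)" by blast
  have contT: "continuous_on (S r) T"
    using T(3) by (meson DERIV_continuous continuous_on_eq_continuous_within)
  \<comment> \<open>The real diameter is taken as a convex subset of the complex plane, so that
    \<open>T\<close> and \<open>u\<close> can be compared through complex derivatives within
    \<open>I\<close>.\<close>
  define I where "I = S r \<inter> \<real>"
  define v where "v z = T z - of_real (u (Re z))" for z
  have I: "\<And>z. z \<in> I \<Longrightarrow> z = of_real (Re z) \<and> \<bar>Re z - x\<bar> \<le> r"
    unfolding I_def S_def by (metis Int_iff Reals_cases Re_complex_of_real dr mem_cball)
  have xI: "of_real x \<in> I" using r by (auto simp: I_def S_def)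
  have convI: "convex I"
    unfolding I_def Reals_def by (intro convex_Int convS convex_linear_image) (auto simp: linear_of_real)
  have compI: "compact I"
    unfolding I_def by (intro compact_Int_closed compS closed_complex_Reals)
  have u1: "of_real (u (Re z)) \<in> cball w0 1" if "z \<in> I" for z
    using d(2)[of "Re z"] I[OF that] r(3) unfolding w0_def mem_cball dist_of_real by (auto simp: dist_real_def)
  have dv: "(v has_field_derivative f z (T z) - f z (of_real (u (Re z)))) (at z within I)" if z: "z \<in> I" for z
  proof -
    obtain D where D: "(u has_real_derivative D) (at (Re z))"
        "of_real D = f (of_real (Re z)) (of_real (u (Re z)))"
      using ode[of "Re z"] I[OF z] r(2) by force
    have "((\<lambda>z. of_real (u (Re z))) has_field_derivative complex_of_real D) (at z within I)"
    proof -
      \<comment> \<open>On \<open>I\<close> the real part is injective, so the real difference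
        quotients of \<open>u\<close> can be pulled back along \<open>Re\<close> to complex
        ones.\<close>
      have "filterlim Re (at (Re z)) (at z within I)"
      proof (rule filterlim_atI)
        show "(Re \<longlongrightarrow> Re z) (at z within I)" by (intro tendsto_intros)
        show "\<forall>\<^sub>F y in at z within I. Re y \<noteq> Re z"
          unfolding eventually_at_filter using I z by (intro always_eventually) metis
      qed
      then have "((\<lambda>y. (u (Re y) - u (Re z)) / (Re y - Re z)) \<longlongrightarrow> D) (at z within I)"
        by (rule filterlim_compose[OF D(1)[unfolded has_field_derivative_iff]])
      then have lim: "((\<lambda>y. complex_of_real ((u (Re y) - u (Re z)) / (Re y - Re z))) \<longlongrightarrow> of_real D) (at z within I)"
        by (rule tendsto_of_real)
      have "of_real ((u (Re y) - u (Re z)) / (Re y - Re z)) = (of_real (u (Re y)) - of_real (u (Re z))) / (y - z)"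
        if "y \<in> I" for y
        using I[OF that] I[OF z] by (metis of_real_diff of_real_divide)
      then have "\<forall>\<^sub>F y in at z within I. complex_of_real ((u (Re y) - u (Re z)) / (Re y - Re z)) =
          (of_real (u (Re y)) - of_real (u (Re z))) / (y - z)"
        unfolding eventually_at_filter by (intro always_eventually) blast
      then show ?thesis
        unfolding has_field_derivative_iff using Lim_transform_eventually[OF lim] by simp
    qed
    moreover have "(T has_field_derivative f z (T z)) (at z within I)"
      by (rule has_field_derivative_subset[OF T(3)]) (use z in \<open>auto simp: I_def\<close>)
    ultimately show ?thesis
      unfolding v_def using D(2) I[OF z] by (auto intro!: derivative_eq_intros)
  qed
  have contv: "continuous_on I v"
    using dv by (meson DERIV_continuous continuous_on_eq_continuous_within)
  \<comment> \<open>Uniqueness without Gronwall: at a maximum point of \<open>norm (v z)\<close> the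
    mean value inequality from the centre gives
    \<open>norm (v z1) \<le> norm (v z1) / 2\<close>.\<close>
  obtain z1 where z1: "z1 \<in> I" "\<And>z. z \<in> I \<Longrightarrow> norm (v z) \<le> norm (v z1)"
    using continuous_attains_sup[OF compI, of "\<lambda>z. norm (v z)"] xI contv by (auto intro: continuous_intros)
  have "norm (v z1 - v (of_real x)) \<le> (L * norm (v z1)) * norm (z1 - of_real x)"
  proof (rule field_differentiable_bound[OF convI dv])
    fix z assume z: "z \<in> I"
    have zS: "z \<in> S r" using z by (simp add: I_def)
    have "norm (f z (T z) - f z (of_real (u (Re z)))) \<le> L * norm (v z)"
      unfolding v_def by (intro lip u1 z T(2) zS subsetD[OF Ssub[OF r(2)]])
    also have "\<dots> \<le> L * norm (v z1)" using z1(2)[OF z] L by simp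
    finally show "norm (f z (T z) - f z (of_real (u (Re z)))) \<le> L * norm (v z1)" .
  qed (use z1 xI in auto)
  also have "\<dots> \<le> (L * norm (v z1)) * r"
    using z1(1) L by (intro mult_left_mono) (auto simp: I_def S_def dist_norm norm_minus_commute)
  also have "\<dots> \<le> norm (v z1) / 2"
    using mult_right_mono[OF r(5), of "norm (v z1)"] by (simp add: algebra_simps)
  finally have "norm (v z1) = 0" using T(1) by (simp add: v_def w0_def)
  then have v0: "v z = 0" if "z \<in> I" for z using z1(2)[OF that] by simp
  show thesis
  proof (rule that[of r T])
    show "continuous_on (ball (of_real x) r \<inter> {z. 0 \<le> Im z}) T"
      by (rule continuous_on_subset[OF contT]) (auto simp: S_def)
    show "T holomorphic_on (ball (of_real x) r \<inter> {z. 0 < Im z})"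
      unfolding int[symmetric] holomorphic_on_def
      by (meson T(3) field_differentiable_def has_field_derivative_subset interior_subset subsetD)
    show "T (of_real y) = of_real (u y)" if "\<bar>y - x\<bar> < r" for y
      using v0[of "of_real y"] that by (auto simp: v_def I_def S_def dr dist_commute abs_minus_commute dist_real_def)
  qed (use r in auto)
qed

section \<open>Logarithmic kernels and sine series\<close>

text \<open>On the closed unit disc the terms are dominated by \<open>norm (a n)\<close>, so the
  partial sums converge uniformly up to the boundary by the Weierstrass test.\<close>

lemma
  fixes a :: "nat \<Rightarrow> complex"
  assumes a: "summable (\<lambda>n. norm (a n))"
  shows continuous_on_abs_summable_power_series: "continuous_on (cball 0 1) (\<lambda>q. \<Sum>n. a n * q ^ n)"
    and holomorphic_on_abs_summable_power_series: "(\<lambda>q. \<Sum>n. a n * q ^ n) holomorphic_on ball 0 1"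
proof -
  have ul: "uniform_limit (cball 0 1) (\<lambda>n q. \<Sum>i<n. a i * q ^ i) (\<lambda>q. \<Sum>n. a n * q ^ n) sequentially"
  proof (rule Weierstrass_m_test[OF _ a])
    show "norm (a n * q ^ n) \<le> norm (a n)" if "q \<in> cball 0 1" for n q
      using that by (simp add: norm_mult norm_power mult_left_le power_le_one)
  qed
  show "continuous_on (cball 0 1) (\<lambda>q. \<Sum>n. a n * q ^ n)"
    by (rule uniform_limit_theorem[OF _ ul]) (auto intro!: always_eventually continuous_intros)
  show "(\<lambda>q. \<Sum>n. a n * q ^ n) holomorphic_on ball 0 1"
  proof (rule holomorphic_uniform_sequence[OF open_ball])
    show "(\<lambda>q. \<Sum>i<n. a i * q ^ i) holomorphic_on ball 0 1" for n
      by (intro holomorphic_intros)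
    fix x :: complex assume "x \<in> ball 0 1"
    then obtain d where "d > 0" "cball x d \<subseteq> ball 0 1"
      using open_contains_cball open_ball by blast
    then show "\<exists>d>0. cball x d \<subseteq> ball 0 1 \<and>
        uniform_limit (cball x d) (\<lambda>n q. \<Sum>i<n. a i * q ^ i) (\<lambda>q. \<Sum>n. a n * q ^ n) sequentially"
      using uniform_limit_on_subset[OF ul] ball_subset_cball by blast
  qed
qed

text \<open>For \<open>\<phi>\<close> between 0 and 2 pi, factoring out
  \<open>cis (\<phi>/2)\<close> leaves the positive modulus \<open>2 * sin (\<phi>/2)\<close> and an
  argument \<open>(\<phi> - pi) / 2\<close> inside the principal range. Negative
  \<open>\<phi>\<close> are shifted by 2 pi; the \<open>sgn\<close> records the jump of the argument
  across 0.\<close>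

lemma Ln_one_minus_cis:
  assumes "\<phi> \<noteq> 0" "\<bar>\<phi>\<bar> < 2 * pi"
  shows "Ln (1 - cis \<phi>) = Complex (ln (2 * \<bar>sin (\<phi>/2)\<bar>)) ((\<phi> - sgn \<phi> * pi) / 2)"
proof -
  have pos: "Ln (1 - cis \<phi>) = Complex (ln (2 * sin (\<phi>/2))) ((\<phi> - pi) / 2)"
    if "0 < \<phi>" "\<phi> < 2 * pi" for \<phi>
  proof -
    have s: "sin (\<phi>/2) > 0" using that by (intro sin_gt_zero) auto
    let ?L = "Complex (ln (2 * sin (\<phi>/2))) ((\<phi> - pi) / 2)"
    have "exp ?L = of_real (2 * sin (\<phi>/2)) * cis ((\<phi> - pi) / 2)"
      using s by (simp add: exp_eq_polar)
    also have "\<dots> = 1 - cis \<phi>"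
    proof (rule complex_eqI)
      have e: "(\<phi> - pi) / 2 = \<phi>/2 - pi/2" by (simp add: field_simps)
      have "cos ((\<phi> - pi) / 2) = sin (\<phi>/2)" "sin ((\<phi> - pi) / 2) = - cos (\<phi>/2)"
        unfolding e by (simp_all add: cos_diff sin_diff)
      moreover have "cos \<phi> = 1 - 2 * (sin (\<phi>/2))\<^sup>2" using cos_double_sin[of "\<phi>/2"] by simp
      moreover have "sin \<phi> = 2 * sin (\<phi>/2) * cos (\<phi>/2)" using sin_double[of "\<phi>/2"] by simp
      ultimately show "Re (of_real (2 * sin (\<phi>/2)) * cis ((\<phi> - pi) / 2)) = Re (1 - cis \<phi>)"
        "Im (of_real (2 * sin (\<phi>/2)) * cis ((\<phi> - pi) / 2)) = Im (1 - cis \<phi>)"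
        by (simp_all add: power2_eq_square)
    qed
    finally have "Ln (1 - cis \<phi>) = Ln (exp ?L)" by simp
    also have "\<dots> = ?L" using that by (intro Ln_exp) auto
    finally show ?thesis .
  qed
  show ?thesis
  proof (cases "\<phi> > 0")
    case True
    then have "sin (\<phi>/2) > 0" using assms by (intro sin_gt_zero) auto
    then show ?thesis using pos[of \<phi>] True assms by simp
  next
    case False
    have "sin (- \<phi>/2) > 0" using assms False by (intro sin_gt_zero) auto
    then have "sin (\<phi>/2) < 0" by simp
    moreover have "cis (\<phi> + 2 * pi) = cis \<phi>" by (simp add: cis.ctr)
    moreover have "sin ((\<phi> + 2 * pi) / 2) = - sin (\<phi>/2)" by (simp add: add_divide_distrib)
    ultimately show ?thesis using pos[of "\<phi> + 2 * pi"] False assms by (simp add: algebra_simps)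
  qed
qed

lemma norm_one_minus_cis: "norm (1 - cis \<phi>) = 2 * \<bar>sin (\<phi>/2)\<bar>"
proof -
  have "(norm (1 - cis \<phi>))\<^sup>2 = (2 * \<bar>sin (\<phi>/2)\<bar>)\<^sup>2"
  proof -
    have "cos \<phi> = 1 - 2 * (sin (\<phi>/2))\<^sup>2" using cos_double_sin[of "\<phi>/2"] by simp
    moreover have "(norm (1 - cis \<phi>))\<^sup>2 = 2 - 2 * cos \<phi>"
      unfolding cmod_power2 using sin_cos_squared_add[of \<phi>] by (simp add: power2_eq_square algebra_simps)
    ultimately show ?thesis by (simp add: power_mult_distrib)
  qed
  then show ?thesis by (rule power2_eq_imp_eq) auto
qed

text \<open>The bound is uniform in \<open>r\<close>, as dominated convergence for radial limits
  requires. With \<open>?w\<close> the argument of \<open>Ln\<close>, both \<open>1 - r\<close> and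
  \<open>norm (1 - cis \<phi>) - (1 - r)\<close> are at most \<open>norm ?w\<close>, hence
  \<open>\<bar>sin (\<phi>/2)\<bar> \<le> norm ?w\<close>. The exponent -1/4 is chosen so that the
  square of the bound is still integrable in \<open>t\<close> near 0. The constant is 9 because real
  and imaginary part are at most \<open>1 + 4 * t powr (-1/4)\<close> and 4, and
  \<open>t powr (-1/4)\<close> is at least 1.\<close>

lemma norm_Ln_one_minus_cis_le:
  fixes r t \<phi> :: real
  assumes r: "0 \<le> r" "r < 1" and t: "0 < t" "t \<le> 1" "t \<le> \<bar>sin (\<phi>/2)\<bar>"
  shows "norm (Ln (1 - of_real r * cis \<phi>)) \<le> 9 * t powr (-1/4)"
proof -
  let ?w = "1 - of_real r * cis \<phi>"
  have n: "norm (of_real r * cis \<phi>) = r" using r by (simp add: norm_mult)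
  have up: "norm ?w \<le> 2" using norm_triangle_ineq4[of 1 "of_real r * cis \<phi>"] n r by simp
  have r1: "1 - r \<le> norm ?w" using norm_triangle_ineq2[of 1 "of_real r * cis \<phi>"] n by simp
  have "1 - cis \<phi> = ?w - of_real (1 - r) * cis \<phi>" by (simp add: algebra_simps)
  then have "norm (1 - cis \<phi>) \<le> norm ?w + norm (of_real (1 - r) * cis \<phi>)"
    by (metis norm_triangle_ineq4)
  also have "norm (of_real (1 - r) * cis \<phi>) = 1 - r" using r by (simp add: norm_mult del: of_real_diff)
  finally have low: "t \<le> norm ?w" using r1 t(3) by (simp add: norm_one_minus_cis)
  have w0: "?w \<noteq> 0" using low t by auto
  have p1: "t powr (-1/4) \<ge> 1"
    using ge_one_powr_ge_zero[of "1/t" "1/4"] t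
    by (simp add: powr_minus_divide powr_divide)
  have "- ln t = 4 * ln (t powr (-1/4))" using t by (simp add: ln_powr)
  also have "\<dots> \<le> 4 * t powr (-1/4)" using ln_le_minus_one[of "t powr (-1/4)"] t by simp
  finally have lnt: "- ln t \<le> 4 * t powr (-1/4)" .
  have "ln (norm ?w) \<le> 1" using up w0 ln_le_minus_one[of "norm ?w"] by simp
  moreover have "ln t \<le> ln (norm ?w)" using low t w0 by (simp add: ln_le_cancel_iff)
  ultimately have re: "\<bar>Re (Ln ?w)\<bar> \<le> 1 + 4 * t powr (-1/4)"
    using lnt p1 w0 by (simp add: Re_Ln abs_le_iff)
  have im: "\<bar>Im (Ln ?w)\<bar> \<le> 4"
    using mpi_less_Im_Ln[OF w0] Im_Ln_le_pi[OF w0] pi_less_4 by auto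
  show ?thesis using cmod_le[of "Ln ?w"] re im p1 by linarith
qed

text \<open>Since \<open>\<bar>x\<bar> \<le> 2\<close>, the cubic Taylor error is at most two thirds
  of \<open>\<bar>x\<bar>\<close>. This is weaker than the sharp constant 2/pi, but enough to
  control the logarithmic singularity.\<close>

lemma abs_sin_ge_third:
  fixes x :: real
  assumes "\<bar>x\<bar> \<le> pi/2"
  shows "\<bar>x\<bar> / 3 \<le> \<bar>sin x\<bar>"
proof -
  have "\<bar>sin x - x\<bar> \<le> \<bar>x\<bar> ^ 3 / 6"
    using Maclaurin_sin_bound[of x 3] by (simp add: eval_nat_numeral sin_coeff_def)
  moreover have "\<bar>x\<bar> ^ 3 \<le> 4 * \<bar>x\<bar>"
  proof -
    have "\<bar>x\<bar> \<le> 2" using assms pi_half_less_two by linarith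
    then have "\<bar>x\<bar> ^ 2 \<le> 2 ^ 2" by (intro power_mono) auto
    then have "\<bar>x\<bar> ^ 2 * \<bar>x\<bar> \<le> 4 * \<bar>x\<bar>" by (intro mult_right_mono) auto
    then show ?thesis by (simp add: eval_nat_numeral algebra_simps)
  qed
  ultimately show ?thesis by linarith
qed

lemma integrable_abs_diff_powr:
  fixes a b c p :: real
  assumes p: "p > -1"
  shows "integrable lborel (\<lambda>s. indicator {a..b} s * \<bar>s - c\<bar> powr p)"
proof -
  define L where "L = \<bar>a - c\<bar> + \<bar>b - c\<bar>"
  have "(\<lambda>x. x powr p) absolutely_integrable_on {0..L}"
    by (intro nonnegative_absolutely_integrable_1 integrable_on_powr_from_0 p) (auto simp: L_def)
  then have h: "integrable lborel (\<lambda>x. indicator {0..L} x * x powr p)" (is "integrable _ ?h")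
    unfolding set_integrable_def by (subst (asm) integrable_completion) auto
  \<comment> \<open>The translate and the reflection of \<open>?h\<close> cover the two sides of the
    singularity at \<open>c\<close>; \<open>L\<close> is at least \<open>\<bar>s - c\<bar>\<close>
    for all \<open>s\<close> in \<open>{a..b}\<close>.\<close>
  have "integrable lborel (\<lambda>s. ?h (- c + 1 * s) + ?h (c + (- 1) * s))"
    by (intro Bochner_Integration.integrable_add lborel_integrable_real_affine[OF h]) auto
  then show ?thesis
    by (rule Bochner_Integration.integrable_bound)
      (auto simp: L_def split: split_indicator intro!: AE_I2)
qed

lemma has_bochner_integral_sin_sin:
  fixes m n :: nat
  assumes "m > 0" "n > 0"
  shows "has_bochner_integral lborel (\<lambda>s. sin (2 * real m * s) * sin (2 * real n * s) * indicator {0..pi/2} s)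
           (if m = n then pi/4 else 0)"
proof (cases "m = n")
  case True
  have "has_bochner_integral lborel (\<lambda>s. sin (2 * real m * s) * sin (2 * real m * s) * indicator {0..pi/2} s)
     ((\<lambda>s. s/2 - sin (4 * real m * s) / (8 * real m)) (pi/2) - (\<lambda>s. s/2 - sin (4 * real m * s) / (8 * real m)) 0)"
  proof (rule has_bochner_integral_FTC_Icc_real)
    fix x :: real
    have "cos (4 * real m * x) = 1 - 2 * (sin (2 * real m * x))\<^sup>2"
      using cos_double_sin[of "2 * real m * x"] by (simp add: algebra_simps)
    then show "((\<lambda>s. s/2 - sin (4 * real m * s) / (8 * real m)) has_real_derivative
        sin (2 * real m * x) * sin (2 * real m * x)) (at x)"
      using assms by (auto intro!: derivative_eq_intros simp: power2_eq_square diff_divide_distrib)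
  qed (auto intro!: continuous_intros)
  moreover have "sin (4 * real m * (pi/2)) = 0"
    using sin_npi[of "2 * m"] by (simp add: algebra_simps)
  ultimately show ?thesis using True by simp
next
  case False
  define d where "d = real m - real n"
  have d: "d \<noteq> 0" using False by (simp add: d_def)
  define e where "e = real m + real n"
  have e: "e \<noteq> 0" using assms by (simp add: e_def)
  let ?F = "\<lambda>s. sin (2 * d * s) / (4 * d) - sin (2 * e * s) / (4 * e)"
  have "has_bochner_integral lborel (\<lambda>s. sin (2 * real m * s) * sin (2 * real n * s) * indicator {0..pi/2} s)
     (?F (pi/2) - ?F 0)"
  proof (rule has_bochner_integral_FTC_Icc_real)
    fix x :: real
    have "sin (2 * real m * x) * sin (2 * real n * x) = (cos (2 * d * x) - cos (2 * e * x)) / 2"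
      using sin_times_sin[of "2 * real m * x" "2 * real n * x"] by (simp add: d_def e_def algebra_simps)
    moreover have "(?F has_real_derivative (cos (2 * d * x) - cos (2 * e * x)) / 2) (at x)"
      using d e by (auto intro!: derivative_eq_intros simp: field_simps)
    ultimately show "(?F has_real_derivative sin (2 * real m * x) * sin (2 * real n * x)) (at x)" by (simp only:)
  qed (auto intro!: continuous_intros)
  moreover have "sin (2 * d * (pi/2)) = 0" "sin (2 * e * (pi/2)) = 0"
    using sin_npi[of "m + n"] sin_diff[of "real m * pi" "real n * pi"] by (auto simp: d_def e_def algebra_simps)
  ultimately show ?thesis using False by simp
qed


section \<open>The boundary trace of a density\<close>

text \<open>A density on (0, pi/2) is carried as a function on the whole line that vanishes outside,
  so that the integrals can be taken over all of \<open>lborel\<close>.\<close>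

locale L2_density =
  fixes f :: "real \<Rightarrow> real"
  assumes meas [measurable]: "f \<in> borel_measurable borel"
    and int2: "integrable lborel (\<lambda>s. (f s)\<^sup>2)"
    and supp: "\<And>s. s \<notin> {0<..<pi/2} \<Longrightarrow> f s = 0"
begin

lemma integrable_density: "integrable lborel f"
proof -
  have "integrable lborel (indicator {0..pi/2} :: real \<Rightarrow> real)"
    by (intro integrable_real_indicator) auto
  then have "integrable lborel (\<lambda>s. indicator {0..pi/2} s + (f s)\<^sup>2)"
    by (intro Bochner_Integration.integrable_add int2)
  then show ?thesis
  proof (rule Bochner_Integration.integrable_bound)
    have "\<bar>f s\<bar> \<le> indicator {0..pi/2} s + (f s)\<^sup>2" for s
    proof (cases "s \<in> {0<..<pi/2}")
      case True
      have "0 \<le> (\<bar>f s\<bar> - 1/2)\<^sup>2" by simp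
      then have "\<bar>f s\<bar> \<le> 1 + (f s)\<^sup>2" by (simp add: power2_eq_square algebra_simps)
      then show ?thesis using True by (auto simp: indicator_def)
    qed (simp add: supp)
    then show "AE s in lborel. norm (f s) \<le> norm (indicator {0..pi/2} s + (f s)\<^sup>2)"
      by (auto intro!: AE_I2 order_trans[OF _ abs_ge_self])
  qed auto
qed

lemma integrable_bounded_mult:
  assumes [measurable]: "g \<in> borel_measurable borel" and "\<And>s. s \<in> {0<..<pi/2} \<Longrightarrow> \<bar>g s\<bar> \<le> B"
  shows "integrable lborel (\<lambda>s. g s * f s)"
proof (rule Bochner_Integration.integrable_bound)
  show "integrable lborel (\<lambda>s. B * f s)" using integrable_density by simp
  show "AE s in lborel. norm (g s * f s) \<le> norm (B * f s)"
  proof (rule AE_I2)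
    fix s show "norm (g s * f s) \<le> norm (B * f s)"
    proof (cases "s \<in> {0<..<pi/2}")
      case True
      show ?thesis using order_trans[OF assms(2)[OF True] abs_ge_self]
        by (auto simp: abs_mult intro!: mult_right_mono)
    qed (simp add: supp)
  qed
qed auto

text \<open>Not normalised: the Fourier coefficients for the orthogonal system
  \<open>sin (2 n s)\<close> on (0, pi/2) are 4/pi times these numbers, each function having squared
  norm pi/4.\<close>

definition sine_coeff :: "nat \<Rightarrow> real" where
  "sine_coeff n = (\<integral>s. sin (2 * real n * s) * f s \<partial>lborel)"

lemma integrable_sin_mult: "integrable lborel (\<lambda>s. sin (2 * real n * s) * f s)"
  by (rule integrable_bounded_mult[where B = 1]) auto

text \<open>The integral of the square of \<open>f\<close> minus the partial sine sum
  \<open>p\<close> is nonnegative. As \<open>p\<close> is the orthogonal projection, the integrals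
  of \<open>p * f\<close> and of the square of \<open>p\<close> have the same value.\<close>

lemma Bessel_inequality: "(\<Sum>n\<in>{1..<N}. (sine_coeff n)\<^sup>2) \<le> pi / 4 * (\<integral>s. (f s)\<^sup>2 \<partial>lborel)"
proof -
  let ?A = "{1..<N}"
  let ?S = "\<Sum>n\<in>?A. (sine_coeff n)\<^sup>2"
  define \<beta> where "\<beta> n = 4 / pi * sine_coeff n" for n
  define p where "p s = (\<Sum>n\<in>?A. \<beta> n * sin (2 * real n * s))" for s
  have 1: "has_bochner_integral lborel (\<lambda>s. p s * f s) (4 / pi * ?S)"
  proof -
    have "has_bochner_integral lborel (\<lambda>s. \<Sum>n\<in>?A. \<beta> n * (sin (2 * real n * s) * f s))
           (\<Sum>n\<in>?A. \<beta> n * sine_coeff n)"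
      unfolding sine_coeff_def
      by (intro has_bochner_integral_sum has_bochner_integral_mult_right has_bochner_integral_integrable integrable_sin_mult)
    then show ?thesis
      by (simp add: p_def \<beta>_def sum_distrib_right sum_distrib_left mult.assoc power2_eq_square)
  qed
  have 2: "has_bochner_integral lborel (\<lambda>s. (p s)\<^sup>2 * indicator {0..pi/2} s) (4 / pi * ?S)"
  proof -
    have "has_bochner_integral lborel
        (\<lambda>s. \<Sum>m\<in>?A. \<Sum>n\<in>?A. (\<beta> m * \<beta> n) * (sin (2 * real m * s) * sin (2 * real n * s) * indicator {0..pi/2} s))
        (\<Sum>m\<in>?A. \<Sum>n\<in>?A. (\<beta> m * \<beta> n) * (if m = n then pi/4 else 0))"
      by (intro has_bochner_integral_sum has_bochner_integral_mult_right has_bochner_integral_sin_sin) auto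
    moreover have "(\<Sum>m\<in>?A. \<Sum>n\<in>?A. (\<beta> m * \<beta> n) * (if m = n then pi/4 else 0)) = 4 / pi * ?S"
      by (simp add: if_distrib[of "\<lambda>x. _ * x"] sum.delta' \<beta>_def sum_distrib_left power2_eq_square
          cong: if_cong)
    moreover have "(\<Sum>m\<in>?A. \<Sum>n\<in>?A. (\<beta> m * \<beta> n) * (sin (2 * real m * s) * sin (2 * real n * s) * indicator {0..pi/2} s))
        = (p s)\<^sup>2 * indicator {0..pi/2} s" for s
    proof -
      have "(p s)\<^sup>2 = (\<Sum>m\<in>?A. \<Sum>n\<in>?A. (\<beta> m * sin (2 * real m * s)) * (\<beta> n * sin (2 * real n * s)))"
        by (simp only: p_def power2_eq_square sum_product)
      then show ?thesis
        by (simp only: sum_distrib_right) (intro sum.cong refl, simp only: mult_ac)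
    qed
    ultimately show ?thesis by simp
  qed
  have "has_bochner_integral lborel (\<lambda>s. (f s)\<^sup>2 - 2 * (p s * f s) + (p s)\<^sup>2 * indicator {0..pi/2} s)
      ((\<integral>s. (f s)\<^sup>2 \<partial>lborel) - 2 * (4 / pi * ?S) + 4 / pi * ?S)"
    by (intro has_bochner_integral_add has_bochner_integral_diff has_bochner_integral_mult_right 1 2
        has_bochner_integral_integrable int2)
  moreover have "(f s)\<^sup>2 - 2 * (p s * f s) + (p s)\<^sup>2 * indicator {0..pi/2} s = (f s - p s * indicator {0..pi/2} s)\<^sup>2" for s
    using supp[of s] by (cases "s \<in> {0..pi/2}") (auto simp: power2_eq_square algebra_simps)
  ultimately have "(\<integral>s. (f s - p s * indicator {0..pi/2} s)\<^sup>2 \<partial>lborel)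
      = (\<integral>s. (f s)\<^sup>2 \<partial>lborel) - 2 * (4 / pi * ?S) + 4 / pi * ?S"
    by (simp only: has_bochner_integral_integral_eq)
  moreover have "0 \<le> (\<integral>s. (f s - p s * indicator {0..pi/2} s)\<^sup>2 \<partial>lborel)" by simp
  ultimately have "0 \<le> (\<integral>s. (f s)\<^sup>2 \<partial>lborel) - 4 / pi * ?S" by linarith
  then show ?thesis by (simp add: field_simps)
qed

text \<open>Bessel gives only square summability; dividing by \<open>n\<close> and comparing
  \<open>x * y\<close> with the sum of the squares of \<open>x\<close> and \<open>y\<close> makes
  the series absolutely summable.\<close>

lemma summable_sine_coeff: "summable (\<lambda>n. \<bar>sine_coeff n\<bar> / real n)"
proof -
  have "sine_coeff 0 = 0" by (simp add: sine_coeff_def)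
  then have "(\<Sum>n<N. (sine_coeff n)\<^sup>2) = (\<Sum>n\<in>{1..<N}. (sine_coeff n)\<^sup>2)" for N
    by (intro sum.mono_neutral_right) (auto simp: not_le)
  then have "summable (\<lambda>n. (sine_coeff n)\<^sup>2)"
    using Bessel_inequality by (intro summableI_nonneg_bounded[where x = "pi / 4 * (\<integral>s. (f s)\<^sup>2 \<partial>lborel)"]) auto
  then have "summable (\<lambda>n. (sine_coeff n)\<^sup>2 + inverse (real n ^ 2))"
    by (intro summable_add inverse_power_summable) auto
  then show ?thesis
  proof (rule summable_comparison_test'[where N = 0])
    fix n :: nat
    have "0 \<le> (\<bar>sine_coeff n\<bar> - inverse (real n))\<^sup>2" by simp
    then have "2 * (\<bar>sine_coeff n\<bar> * inverse (real n)) \<le> (sine_coeff n)\<^sup>2 + (inverse (real n))\<^sup>2"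
      by (simp add: power2_diff mult.assoc)
    moreover have "0 \<le> \<bar>sine_coeff n\<bar> * inverse (real n)" by simp
    ultimately have "\<bar>sine_coeff n\<bar> * inverse (real n) \<le> (sine_coeff n)\<^sup>2 + (inverse (real n))\<^sup>2"
      by linarith
    then show "norm (\<bar>sine_coeff n\<bar> / real n) \<le> (sine_coeff n)\<^sup>2 + inverse (real n ^ 2)"
      by (simp add: divide_inverse power_inverse abs_mult)
  qed
qed

definition disc_fun :: "complex \<Rightarrow> complex" where
  "disc_fun q = (\<Sum>n. of_real (sine_coeff n / real n) * q ^ n)"

lemma continuous_on_disc_fun: "continuous_on (cball 0 1) disc_fun"
  and holomorphic_on_disc_fun: "disc_fun holomorphic_on ball 0 1"
proof -
  have "summable (\<lambda>n. norm (complex_of_real (sine_coeff n / real n)))"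
    using summable_sine_coeff by (simp add: norm_divide)
  note * = continuous_on_abs_summable_power_series[OF this] holomorphic_on_abs_summable_power_series[OF this]
  then show "continuous_on (cball 0 1) disc_fun" "disc_fun holomorphic_on ball 0 1"
    unfolding disc_fun_def by auto
qed

lemma cnj_disc_fun:
  assumes "norm q \<le> 1"
  shows "disc_fun (cnj q) = cnj (disc_fun q)"
proof -
  have "summable (\<lambda>n. of_real (sine_coeff n / real n) * q ^ n)"
  proof (rule summable_comparison_test'[OF summable_sine_coeff, where N = 0])
    show "norm (of_real (sine_coeff n / real n) * q ^ n) \<le> \<bar>sine_coeff n\<bar> / real n" for n
      using power_le_one[of "norm q" n] assms mult_left_le[of "norm q ^ n" "\<bar>sine_coeff n\<bar> / real n"]
      by (simp add: norm_mult norm_divide norm_power)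
  qed
  then have "(\<lambda>n. of_real (sine_coeff n / real n) * q ^ n) sums disc_fun q"
    unfolding disc_fun_def by (rule summable_sums)
  then have "(\<lambda>n. cnj (of_real (sine_coeff n / real n) * q ^ n)) sums cnj (disc_fun q)"
    by (subst sums_cnj)
  then show ?thesis unfolding disc_fun_def by (simp add: sums_iff)
qed

text \<open>For \<open>r < 1\<close> both logarithms expand into power series, and a geometric bound
  allows termwise integration. In the difference the exponentials at \<open>\<sigma> + s\<close> and
  \<open>\<sigma> - s\<close> combine into \<open>cis (2 * \<sigma>) ^ n\<close> times a sine in
  \<open>s\<close>, which integrates to \<open>sine_coeff n\<close>.\<close>

lemma Abel_integral:
  fixes r \<sigma> :: real
  assumes r: "0 \<le> r" "r < 1"
  shows "(\<integral>s. (Ln (1 - of_real r * cis (2 * (\<sigma> + s))) - Ln (1 - of_real r * cis (2 * (\<sigma> - s)))) * of_real (f s) \<partial>lborel)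
           = - 2 * \<i> * disc_fun (of_real r * cis (2 * \<sigma>))"
proof -
  \<comment> \<open>For \<open>n = 0\<close> division by zero gives \<open>c 0 = 0\<close>, in
    accordance with the missing constant term of the logarithm.\<close>
  define c where "c n = - 2 * \<i> * (of_real r * cis (2 * \<sigma>)) ^ n / of_nat n" for n :: nat
  define g where "g n s = c n * of_real (sin (2 * real n * s) * f s)" for n s
  have nc: "norm (c n) \<le> 2 * r ^ n" for n
    using r divide_left_mono[of 1 "real n" "2 * r ^ n"]
    by (cases "n = 0") (auto simp: c_def norm_mult norm_divide norm_power)
  have sm: "summable (\<lambda>n. 2 * r ^ n)" using r by (intro summable_mult summable_geometric) auto
  have "(\<lambda>n. \<integral>s. g n s \<partial>lborel) sums (\<integral>s. (\<Sum>n. g n s) \<partial>lborel)"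
  proof (rule sums_integral)
    show int: "integrable lborel (g n)" for n
      unfolding g_def by (intro integrable_mult_right integrable_of_real integrable_sin_mult)
    have bd: "norm (g n s) \<le> 2 * r ^ n * \<bar>f s\<bar>" for n s
    proof -
      have "\<bar>sin (2 * real n * s) * f s\<bar> \<le> 1 * \<bar>f s\<bar>"
        unfolding abs_mult by (intro mult_right_mono) auto
      then show ?thesis
        unfolding g_def norm_mult norm_of_real using mult_mono[OF nc[of n], of "\<bar>sin (2 * real n * s) * f s\<bar>" "\<bar>f s\<bar>"] r by simp
    qed
    show "AE s in lborel. summable (\<lambda>n. norm (g n s))"
      using bd by (intro AE_I2 summable_comparison_test'[OF summable_mult2[OF sm], where N = 0]) auto
    show "summable (\<lambda>n. \<integral>s. norm (g n s) \<partial>lborel)"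
    proof (rule summable_comparison_test'[OF summable_mult2[OF sm], where N = 0])
      fix n :: nat
      have "(\<integral>s. norm (g n s) \<partial>lborel) \<le> (\<integral>s. 2 * r ^ n * \<bar>f s\<bar> \<partial>lborel)"
        using bd int integrable_density by (intro integral_mono) auto
      then show "norm (\<integral>s. norm (g n s) \<partial>lborel) \<le> 2 * r ^ n * (\<integral>s. \<bar>f s\<bar> \<partial>lborel)"
        by simp
    qed
  qed
  moreover have "(\<integral>s. g n s \<partial>lborel) = - 2 * \<i> * (of_real (sine_coeff n / real n) * (of_real r * cis (2 * \<sigma>)) ^ n)" for n
    by (simp only: g_def integral_mult_right_zero integral_complex_of_real sine_coeff_def[symmetric]) (simp add: c_def)
  moreover have "(\<Sum>n. g n s) = (Ln (1 - of_real r * cis (2 * (\<sigma> + s))) - Ln (1 - of_real r * cis (2 * (\<sigma> - s)))) * of_real (f s)" for s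
  proof -
    have L: "(\<lambda>n. - ((of_real r * cis \<phi>) ^ n) / of_nat n) sums Ln (1 - of_real r * cis \<phi>)" for \<phi>
      using Ln_series'[of "- of_real r * cis \<phi>"] r by (simp add: norm_mult)
    have t: "(- ((of_real r * cis (2 * (\<sigma> + s))) ^ n) / of_nat n - (- ((of_real r * cis (2 * (\<sigma> - s))) ^ n) / of_nat n)) * of_real (f s) = g n s" for n
    proof -
      have "cis (2 * (\<sigma> + s)) ^ n - cis (2 * (\<sigma> - s)) ^ n = cis (2 * \<sigma>) ^ n * (2 * \<i> * of_real (sin (2 * real n * s)))"
      proof -
        have "cis (2 * (\<sigma> + s)) ^ n - cis (2 * (\<sigma> - s)) ^ n = cis (2 * \<sigma>) ^ n * (cis (2 * real n * s) - cis (- (2 * real n * s)))"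
          by (simp add: Complex.DeMoivre cis_mult algebra_simps)
        also have "cis (2 * real n * s) - cis (- (2 * real n * s)) = 2 * \<i> * of_real (sin (2 * real n * s))"
          by (simp add: complex_eq_iff)
        finally show ?thesis .
      qed
      then have "- (of_real r ^ n * (cis (2 * (\<sigma> + s)) ^ n - cis (2 * (\<sigma> - s)) ^ n) / of_nat n) * of_real (f s) = g n s"
        by (simp add: g_def c_def power_mult_distrib)
      then show ?thesis by (simp add: power_mult_distrib diff_divide_distrib algebra_simps)
    qed
    show ?thesis
      using sums_mult2[OF sums_diff[OF L[of "2 * (\<sigma> + s)"] L[of "2 * (\<sigma> - s)"]], of "of_real (f s)"]
      unfolding t by (simp add: sums_iff)
  qed
  ultimately have "(\<lambda>n. - 2 * \<i> * (of_real (sine_coeff n / real n) * (of_real r * cis (2 * \<sigma>)) ^ n)) sums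
     (\<integral>s. (Ln (1 - of_real r * cis (2 * (\<sigma> + s))) - Ln (1 - of_real r * cis (2 * (\<sigma> - s)))) * of_real (f s) \<partial>lborel)"
    by simp
  moreover have "(\<lambda>n. of_real (sine_coeff n / real n) * (of_real r * cis (2 * \<sigma>)) ^ n) sums disc_fun (of_real r * cis (2 * \<sigma>))"
  proof -
    have "norm (of_real (sine_coeff n / real n) * (of_real r * cis (2 * \<sigma>)) ^ n) \<le> \<bar>sine_coeff n\<bar> / real n" for n
      using power_le_one[of r n] r mult_left_le[of "r ^ n" "\<bar>sine_coeff n\<bar> / real n"]
      by (simp add: norm_mult norm_divide norm_power)
    then show ?thesis unfolding disc_fun_def
      by (intro summable_sums summable_comparison_test'[OF summable_sine_coeff, where N = 0])
  qed
  ultimately show ?thesis using sums_mult sums_unique2 by blast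
qed

text \<open>Abel summation: the radial limit is taken by dominated convergence, with a dominating function
  built from \<open>\<bar>log t\<bar> \<le> 4 t\<^bsup>-1/4\<^esup>\<close> and \<open>f \<in> L\<^sup>2\<close>.\<close>

lemma disc_fun_boundary:
  assumes \<sigma>: "0 < \<sigma>" "\<sigma> \<le> pi/2"
  shows "- 2 * \<i> * disc_fun (cis (2 * \<sigma>)) =
    Complex (\<integral>s. kerK s \<sigma> * f s \<partial>lborel) (\<integral>s. (2 * s - (if \<sigma> < s then pi else 0)) * f s \<partial>lborel)"
proof -
  \<comment> \<open>Radii in [0, 1) that tend to 1.\<close>
  define \<rho> where "\<rho> k = real (Suc k) / real (k + 2)" for k
  have \<rho>: "0 \<le> \<rho> k" "\<rho> k < 1" for k by (auto simp: \<rho>_def)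
  have "(\<lambda>k. 1 - inverse (real (Suc (Suc k)))) \<longlonglongrightarrow> 1 - 0"
    using LIMSEQ_Suc[OF LIMSEQ_inverse_real_of_nat] by (intro tendsto_diff tendsto_const)
  moreover have "1 - inverse (real (Suc (Suc k))) = \<rho> k" for k by (simp add: \<rho>_def field_simps)
  ultimately have \<rho>1: "\<rho> \<longlonglongrightarrow> 1" by simp
  define u where "u k s = (Ln (1 - of_real (\<rho> k) * cis (2 * (\<sigma> + s))) - Ln (1 - of_real (\<rho> k) * cis (2 * (\<sigma> - s)))) * of_real (f s)" for k s
  define v where "v s = complex_of_real (kerK s \<sigma> * f s) + \<i> * of_real ((2 * s - (if \<sigma> < s then pi else 0)) * f s)" for s
  \<comment> \<open>The dominating function: each logarithm is at most 9 \<open>b\<close> with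
    \<open>b = (\<bar>s - \<sigma>\<bar> / 3) powr (-1/4)\<close>, and 18 \<open>b\<close> times
    \<open>\<bar>f s\<bar>\<close> is at most the sum of the two squares, whence 324.\<close>
  define w where "w s = 324 * ((indicator {0..pi/2} s * \<bar>s - \<sigma>\<bar> powr (-1/2)) * (1/3) powr (-1/2)) + (f s)\<^sup>2" for s
  have AEn: "AE s in lborel. s \<noteq> \<sigma>" by (rule AE_lborel_singleton)
  have um [measurable]: "u k \<in> borel_measurable lborel" for k
  proof -
    have "1 - of_real (\<rho> k) * cis \<phi> \<notin> \<real>\<^sub>\<le>\<^sub>0" for \<phi>
    proof -
      have "\<rho> k * cos \<phi> \<le> \<rho> k * 1" using \<rho> by (intro mult_left_mono) auto
      then have "Re (1 - of_real (\<rho> k) * cis \<phi>) > 0" using \<rho>[of k] by simp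
      then show ?thesis by (auto simp: complex_nonpos_Reals_iff)
    qed
    then have "continuous_on UNIV (\<lambda>s. Ln (1 - of_real (\<rho> k) * cis (2 * (\<sigma> + s))) - Ln (1 - of_real (\<rho> k) * cis (2 * (\<sigma> - s))))"
      by (intro continuous_intros) auto
    from borel_measurable_continuous_onI[OF this] show ?thesis unfolding u_def by measurable
  qed
  have vm: "v \<in> borel_measurable lborel" unfolding v_def kerK_def by measurable
  have wi: "integrable lborel w"
    unfolding w_def
    by (intro Bochner_Integration.integrable_add int2 integrable_mult_right integrable_mult_left integrable_abs_diff_powr) auto
  have uv: "AE s in lborel. (\<lambda>k. u k s) \<longlonglongrightarrow> v s"
    using AEn
  proof eventually_elim
    fix s assume s: "s \<noteq> \<sigma>"
    show "(\<lambda>k. u k s) \<longlonglongrightarrow> v s"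
    proof (cases "s \<in> {0<..<pi/2}")
      case True
      have nz: "1 - cis \<phi> \<notin> \<real>\<^sub>\<le>\<^sub>0" if "\<phi> \<noteq> 0" "\<bar>\<phi>\<bar> < 2 * pi" for \<phi>
      proof -
        have "sin (\<bar>\<phi>\<bar>/2) > 0" using that by (intro sin_gt_zero) auto
        moreover have "cos \<phi> = 1 - 2 * (sin (\<bar>\<phi>\<bar>/2))\<^sup>2" using cos_double_sin[of "\<bar>\<phi>\<bar>/2"] by simp
        ultimately have "Re (1 - cis \<phi>) > 0" by simp
        then show ?thesis by (auto simp: complex_nonpos_Reals_iff)
      qed
      have "(\<lambda>k. u k s) \<longlonglongrightarrow> (Ln (1 - of_real 1 * cis (2 * (\<sigma> + s))) - Ln (1 - of_real 1 * cis (2 * (\<sigma> - s)))) * of_real (f s)"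
      proof -
        have "1 - cis (2 * (\<sigma> + s)) \<notin> \<real>\<^sub>\<le>\<^sub>0" "1 - cis (2 * (\<sigma> - s)) \<notin> \<real>\<^sub>\<le>\<^sub>0"
          by (rule nz; use s True \<sigma> in auto)+
        then show ?thesis unfolding u_def using \<rho>1 by (intro tendsto_intros) simp_all
      qed
      also have "(Ln (1 - of_real 1 * cis (2 * (\<sigma> + s))) - Ln (1 - of_real 1 * cis (2 * (\<sigma> - s)))) * of_real (f s) = v s"
      proof -
        have 1: "Ln (1 - cis (2 * (\<sigma> + s))) = Complex (ln (2 * \<bar>sin (\<sigma> + s)\<bar>)) (\<sigma> + s - pi/2)"
          using Ln_one_minus_cis[of "2 * (\<sigma> + s)"] True \<sigma> by (simp add: diff_divide_distrib add_divide_distrib)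
        have 2: "Ln (1 - cis (2 * (\<sigma> - s))) = Complex (ln (2 * \<bar>sin (\<sigma> - s)\<bar>)) (\<sigma> - s - sgn (\<sigma> - s) * (pi/2))"
        proof -
          define d where "d = \<sigma> - s"
          have "d \<noteq> 0" "\<bar>d\<bar> < pi" using True \<sigma> s by (auto simp: d_def)
          then show ?thesis
            using Ln_one_minus_cis[of "2 * d"] unfolding d_def[symmetric] by (simp add: diff_divide_distrib sgn_mult abs_mult)
        qed
        have "sin (\<sigma> + s) > 0" using True \<sigma> by (intro sin_gt_zero) auto
        moreover have "sin (\<sigma> - s) \<noteq> 0"
        proof -
          have "\<bar>\<sigma> - s\<bar> \<le> pi/2" using True \<sigma> unfolding greaterThanLessThan_iff by linarith
          then show ?thesis using abs_sin_ge_third[of "\<sigma> - s"] s by auto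
        qed
        moreover have "\<bar>sin (s - \<sigma>)\<bar> = \<bar>sin (\<sigma> - s)\<bar>" by (metis abs_minus_cancel minus_diff_eq sin_minus)
        ultimately have ker: "kerK s \<sigma> = ln (2 * \<bar>sin (\<sigma> + s)\<bar>) - ln (2 * \<bar>sin (\<sigma> - s)\<bar>)"
          unfolding kerK_def by (simp add: ln_div ln_mult abs_divide add.commute)
        \<comment> \<open>The imaginary parts of the two logarithms differ by \<open>2 * s\<close>
          for \<open>s < \<sigma>\<close> and by \<open>2 * s - pi\<close> for
          \<open>s > \<sigma>\<close>; this is the step function in the statement.\<close>
        show ?thesis
          using s unfolding of_real_1 mult_1 1 2 v_def ker by (simp add: complex_eq_iff algebra_simps sgn_if)
      qed
      finally show ?thesis .
    qed (simp add: u_def v_def supp)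
  qed
  have dom: "AE s in lborel. norm (u k s) \<le> w s" for k
    using AEn
  proof eventually_elim
    fix s assume s: "s \<noteq> \<sigma>"
    show "norm (u k s) \<le> w s"
    proof (cases "s \<in> {0<..<pi/2}")
      case True
      define t where "t = \<bar>\<sigma> - s\<bar> / 3"
      define b where "b = t powr (-1/4)"
      have "\<bar>\<sigma> - s\<bar> \<le> pi/2" using True \<sigma> unfolding greaterThanLessThan_iff by linarith
      then have ts: "t \<le> \<bar>sin (\<sigma> - s)\<bar>" unfolding t_def by (rule abs_sin_ge_third)
      have t0: "0 < t" using s by (simp add: t_def)
      have t1: "t \<le> 1" using ts abs_sin_le_one order_trans by blast
      \<comment> \<open>On this quarter period \<open>\<bar>sin (\<sigma> - s)\<bar>\<close> is the
        smaller of the two sines, so one lower bound \<open>t\<close> serves both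
        logarithms.\<close>
      have "0 \<le> sin \<sigma> * cos s" "0 \<le> cos \<sigma> * sin s"
        using True \<sigma> by (auto intro!: mult_nonneg_nonneg sin_ge_zero cos_ge_zero)
      then have "\<bar>sin (\<sigma> - s)\<bar> \<le> \<bar>sin (\<sigma> + s)\<bar>" unfolding sin_diff sin_add by linarith
      then have "norm (Ln (1 - of_real (\<rho> k) * cis (2 * (\<sigma> + s)))) \<le> 9 * b" "norm (Ln (1 - of_real (\<rho> k) * cis (2 * (\<sigma> - s)))) \<le> 9 * b"
        using norm_Ln_one_minus_cis_le[OF \<rho> t0 t1, of "2 * (\<sigma> + s)" k]
          norm_Ln_one_minus_cis_le[OF \<rho> t0 t1, of "2 * (\<sigma> - s)" k] ts
        unfolding b_def by (simp_all only: nonzero_mult_div_cancel_left numeral_neq_zero simp_thms)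
      then have "norm (Ln (1 - of_real (\<rho> k) * cis (2 * (\<sigma> + s))) - Ln (1 - of_real (\<rho> k) * cis (2 * (\<sigma> - s)))) \<le> 18 * b"
        using norm_triangle_ineq4[of "Ln (1 - of_real (\<rho> k) * cis (2 * (\<sigma> + s)))" "Ln (1 - of_real (\<rho> k) * cis (2 * (\<sigma> - s)))"] by linarith
      then have "norm (u k s) \<le> 18 * b * \<bar>f s\<bar>" unfolding u_def norm_mult norm_of_real by (intro mult_right_mono) auto
      also have "\<dots> \<le> (18 * b)\<^sup>2 + (f s)\<^sup>2"
      proof -
        have "0 \<le> (18 * b - \<bar>f s\<bar>)\<^sup>2" by simp
        then have "2 * (18 * b * \<bar>f s\<bar>) \<le> (18 * b)\<^sup>2 + (f s)\<^sup>2" by (simp add: power2_diff mult.assoc)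
        moreover have "0 \<le> 18 * b * \<bar>f s\<bar>" by (simp add: b_def)
        ultimately show ?thesis by linarith
      qed
      also have "(18 * b)\<^sup>2 = 324 * (b * b)" by (simp add: power2_eq_square)
      also have "b * b = t powr (-1/2)" by (simp add: b_def flip: powr_add)
      also have "t powr (-1/2) = \<bar>s - \<sigma>\<bar> powr (-1/2) * (1/3) powr (-1/2)"
        unfolding t_def by (subst powr_mult[symmetric]) (auto simp: abs_minus_commute)
      finally show ?thesis using True by (simp add: w_def)
    qed (simp add: u_def w_def supp)
  qed
  have lim: "(\<lambda>k. \<integral>s. u k s \<partial>lborel) \<longlonglongrightarrow> (\<integral>s. v s \<partial>lborel)"
    by (rule integral_dominated_convergence[OF vm um wi uv dom])
  have vi: "integrable lborel v"
    by (rule integrable_dominated_convergence[OF vm um wi uv dom])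
  have "(\<lambda>k. - 2 * \<i> * disc_fun (of_real (\<rho> k) * cis (2 * \<sigma>))) \<longlonglongrightarrow> - 2 * \<i> * disc_fun (of_real 1 * cis (2 * \<sigma>))"
  proof (intro tendsto_intros continuous_on_tendsto_compose[OF continuous_on_disc_fun] \<rho>1)
    show "\<forall>\<^sub>F k in sequentially. of_real (\<rho> k) * cis (2 * \<sigma>) \<in> cball 0 1"
      using \<rho> by (intro always_eventually) (auto simp: norm_mult less_imp_le)
  qed (auto simp: norm_mult)
  then have "- 2 * \<i> * disc_fun (cis (2 * \<sigma>)) = (\<integral>s. v s \<partial>lborel)"
    using LIMSEQ_unique[OF lim] unfolding u_def Abel_integral[OF \<rho>] by simp
  moreover have "(\<integral>s. v s \<partial>lborel) = Complex (\<integral>s. Re (v s) \<partial>lborel) (\<integral>s. Im (v s) \<partial>lborel)"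
    using vi by (simp add: complex_eq_iff)
  ultimately show ?thesis by (simp add: v_def)
qed

end

text \<open>At the centre \<open>c\<close> of the reflection \<open>prim\<close> only controls the left derivative; comparing with
  a primitive of \<open>\<phi>\<close> across \<open>c\<close>, which is even since \<open>\<phi>\<close> is odd, handles both sides at once.\<close>

lemma reflected_primitive_has_derivative:
  fixes w \<phi> :: "real \<Rightarrow> real" and c :: real
  assumes cont: "continuous_on {0<..<2 * c} \<phi>"
    and odd: "\<And>x. x \<in> {0<..<2 * c} \<Longrightarrow> \<phi> (2 * c - x) = - \<phi> x"
    and even: "\<And>x. x \<in> {0<..<2 * c} \<Longrightarrow> w (2 * c - x) = w x"
    and prim: "\<And>a. 0 < a \<Longrightarrow> a \<le> c \<Longrightarrow> w c - w a = (\<integral>s. \<phi> s * indicator {a..c} s \<partial>lborel)"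
    and x: "x \<in> {0<..<2 * c}"
  shows "(w has_real_derivative \<phi> x) (at x)"
proof -
  \<comment> \<open>The interval \<open>?J\<close> below is compact, symmetric about
    \<open>c\<close>, and has \<open>x\<close> in its interior.\<close>
  define \<delta> where "\<delta> = min x (2 * c - x) / 2"
  have \<delta>: "0 < \<delta>" "\<delta> < x" "x < 2 * c - \<delta>" "\<delta> < c"
  proof -
    have "\<delta> \<le> x / 2" "\<delta> \<le> (2 * c - x) / 2" "0 < \<delta>" "0 < x" "x < 2 * c" using x by (auto simp: \<delta>_def)
    then show "0 < \<delta>" "\<delta> < x" "x < 2 * c - \<delta>" "\<delta> < c" by (simp_all add: field_simps)
  qed
  let ?J = "{\<delta>..2 * c - \<delta>}"
  have "continuous_on ?J \<phi>" by (rule continuous_on_subset[OF cont]) (use \<delta> in auto)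
  then obtain P where "\<And>y. y \<in> ?J \<Longrightarrow> (P has_vector_derivative \<phi> y) (at y within ?J)"
    using antiderivative_continuous by blast
  then have P: "(P has_real_derivative \<phi> y) (at y within ?J)" if "y \<in> ?J" for y
    using that by (simp add: has_real_derivative_iff_has_vector_derivative)
  have PR: "((\<lambda>y. P (2 * c - y)) has_real_derivative \<phi> y) (at y within ?J)" if y: "y \<in> ?J" for y
  proof -
    have "(\<lambda>y. 2 * c - y) ` ?J \<subseteq> ?J" by auto
    then have "(P has_real_derivative \<phi> (2 * c - y)) (at (2 * c - y) within (\<lambda>y. 2 * c - y) ` ?J)"
      using y by (intro has_field_derivative_subset[OF P]) auto
    moreover have "((\<lambda>y. 2 * c - y) has_real_derivative - 1) (at y within ?J)"
      by (auto intro!: derivative_eq_intros)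
    ultimately have "((P \<circ> (\<lambda>y. 2 * c - y)) has_real_derivative \<phi> (2 * c - y) * (- 1)) (at y within ?J)"
      by (rule DERIV_image_chain)
    then show ?thesis using odd[of y] y \<delta> by (simp add: o_def)
  qed
  have "((\<lambda>y. P (2 * c - y) - P y) has_real_derivative 0) (at y within ?J)" if "y \<in> ?J" for y
    using DERIV_diff[OF PR[OF that] P[OF that]] by simp
  from has_field_derivative_zero_constant[OF _ this]
  obtain k where k: "\<And>y. y \<in> ?J \<Longrightarrow> P (2 * c - y) - P y = k" by auto
  \<comment> \<open>The constant is evaluated at the fixed point \<open>c\<close> of the
    reflection.\<close>
  have "k = 0" using k[of c] \<delta> by simp
  then have Psym: "P (2 * c - y) = P y" if "y \<in> ?J" for y using k[OF that] by simp
  have left: "w y = P y + (w c - P c)" if y: "\<delta> \<le> y" "y \<le> c" for y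
  proof -
    have sub: "{y..c} \<subseteq> ?J" using y \<delta> by auto
    have "(\<integral>s. indicator {y..c} s *\<^sub>R \<phi> s \<partial>lborel) = P c - P y"
    proof (rule integral_FTC_Icc[OF y(2)])
      show "(P has_vector_derivative \<phi> s) (at s within {y..c})" if "y \<le> s" "s \<le> c" for s
        unfolding has_real_derivative_iff_has_vector_derivative[symmetric]
        by (rule has_field_derivative_subset[OF P]) (use that sub in auto)
      show "continuous_on {y..c} \<phi>" by (rule continuous_on_subset[OF cont]) (use y \<delta> in auto)
    qed
    then show ?thesis using prim[of y] y \<delta> by (simp add: mult.commute)
  qed
  have eq: "w y = P y + (w c - P c)" if y: "y \<in> ?J" for y
  proof (cases "y \<le> c")
    case True
    then show ?thesis using y by (intro left) auto
  next
    case False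
    then show ?thesis using left[of "2 * c - y"] even[of y] Psym[OF y] y \<delta> by simp
  qed
  have "(P has_real_derivative \<phi> x) (at x within {\<delta><..<2 * c - \<delta>})"
    by (rule has_field_derivative_subset[OF P]) (use \<delta> in auto)
  then have "(P has_real_derivative \<phi> x) (at x)"
    using \<delta> by (subst (asm) at_within_open) auto
  then have "((\<lambda>y. P y + (w c - P c)) has_real_derivative \<phi> x) (at x)"
    by (auto intro!: derivative_eq_intros)
  then show ?thesis
  proof (rule has_field_derivative_transform_within_open[where S = "{\<delta><..<2 * c - \<delta>}"])
    show "P y + (w c - P c) = w y" if "y \<in> {\<delta><..<2 * c - \<delta>}" for y
      using eq[of y] that by simp
  qed (use \<delta> in auto)
qed

section \<open>Extension of the boundary trace to the upper half plane\<close>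

context L2_density
begin

text \<open>The added imaginary constant turns the weight \<open>2 * s - pi\<close> on
  \<open>s > \<sigma>\<close>, \<open>2 * s\<close> elsewhere, into \<open>pi\<close> on
  \<open>s \<le> \<sigma>\<close> and 0 elsewhere. After division by 3 pi the trace on (0, pi/2] is
  a third of the operator applied to \<open>f\<close>, plus \<open>\<i>\<close> times a third of the
  primitive of \<open>f\<close>.\<close>

definition half_plane_fun :: "complex \<Rightarrow> complex" where
  "half_plane_fun z = (- 2 * \<i> * disc_fun (exp (2 * \<i> * z)) + \<i> * of_real (\<integral>s. (pi - 2 * s) * f s \<partial>lborel))
     / of_real (3 * pi)"

lemma continuous_on_half_plane_fun: "continuous_on {z. 0 \<le> Im z} half_plane_fun"
  unfolding half_plane_fun_def
  by (intro continuous_intros continuous_on_compose2[OF continuous_on_disc_fun]) auto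

lemma holomorphic_on_half_plane_fun: "half_plane_fun holomorphic_on {z. 0 < Im z}"
proof -
  have "(\<lambda>z. disc_fun (exp (2 * \<i> * z))) holomorphic_on {z. 0 < Im z}"
    by (rule holomorphic_on_compose_gen[OF _ holomorphic_on_disc_fun, unfolded o_def])
       (auto intro!: holomorphic_intros)
  then show ?thesis
    unfolding half_plane_fun_def by (intro holomorphic_intros) auto
qed

lemma half_plane_fun_of_real:
  assumes \<sigma>: "0 < \<sigma>" "\<sigma> \<le> pi/2"
  shows "half_plane_fun (of_real \<sigma>) =
    Complex ((\<integral>s. kerK s \<sigma> * f s \<partial>lborel) / (3 * pi)) ((\<integral>s. indicator {0..\<sigma>} s * f s \<partial>lborel) / 3)"
proof -
  have e: "exp (2 * \<i> * of_real \<sigma>) = cis (2 * \<sigma>)"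
    by (simp add: cis_conv_exp mult_ac)
  have j: "(\<integral>s. (2 * s - (if \<sigma> < s then pi else 0)) * f s \<partial>lborel)
      = pi * (\<integral>s. indicator {0..\<sigma>} s * f s \<partial>lborel) - (\<integral>s. (pi - 2 * s) * f s \<partial>lborel)"
  proof -
    have i: "integrable lborel (\<lambda>s. (pi - 2 * s) * f s)" "integrable lborel (\<lambda>s. indicator {0..\<sigma>} s * f s)"
      by (rule integrable_bounded_mult[where B = pi]; auto)
         (rule integrable_bounded_mult[where B = 1]; auto)
    have "(2 * s - (if \<sigma> < s then pi else 0)) * f s = pi * (indicator {0..\<sigma>} s * f s) - (pi - 2 * s) * f s" for s
      using supp[of s] by (cases "s \<in> {0<..<pi/2}") (auto simp: algebra_simps indicator_def)
    then show ?thesis using i by simp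
  qed
  show ?thesis
    unfolding half_plane_fun_def e disc_fun_boundary[OF \<sigma>] j
    by (simp add: complex_eq_iff Re_divide_of_real Im_divide_of_real del: of_real_mult)
qed

text \<open>Reflection about pi/2 conjugates \<open>exp (2 * \<i> * \<sigma>)\<close>, and
  \<open>disc_fun\<close> has real coefficients. The real part of the trace is thus odd and the
  imaginary part even about pi/2, matching the prescribed extensions.\<close>

lemma half_plane_fun_reflect:
  "half_plane_fun (of_real (pi - \<sigma>)) = - cnj (half_plane_fun (of_real \<sigma>))"
proof -
  have "exp (2 * \<i> * of_real (pi - \<sigma>)) = exp (2 * of_real pi * \<i>) * exp (- 2 * \<i> * of_real \<sigma>)"
    by (simp only: exp_add[symmetric]) (simp add: algebra_simps)
  also have "\<dots> = cnj (exp (2 * \<i> * of_real \<sigma>))"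
    by (simp add: exp_cnj)
  finally have "disc_fun (exp (2 * \<i> * of_real (pi - \<sigma>))) = cnj (disc_fun (exp (2 * \<i> * of_real \<sigma>)))"
    by (simp add: cnj_disc_fun)
  then show ?thesis
    by (simp add: half_plane_fun_def field_simps)
qed

end


section \<open>Analyticity\<close>

text \<open>The two integrands differ at most at the endpoints 0 and \<open>c\<close>, a null set on
  which nothing is assumed about \<open>\<zeta>\<close>.\<close>

lemma set_integral_atLeastAtMost_eq_cut_off:
  fixes \<zeta> :: "real \<Rightarrow> real"
  assumes "set_borel_measurable lborel {0<..<c} \<zeta>" "\<sigma> \<le> c"
  shows "(LINT s:{0..\<sigma>}|lborel. \<zeta> s) = (\<integral>s. indicator {0..\<sigma>} s * (indicator {0<..<c} s * \<zeta> s) \<partial>lborel)"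
proof -
  have m [measurable]: "(\<lambda>s. indicator {0<..<c} s * \<zeta> s) \<in> borel_measurable borel"
    using assms(1) by (simp add: set_borel_measurable_def)
  have "AE s in lborel. indicator {0..\<sigma>} s *\<^sub>R \<zeta> s = indicator {0..\<sigma>} s * (indicator {0<..<c} s * \<zeta> s)"
    using AE_lborel_singleton[of 0] AE_lborel_singleton[of c]
    by eventually_elim (use assms(2) in \<open>auto simp: indicator_def\<close>)
  moreover have "(\<lambda>s. indicator {0..\<sigma>} s *\<^sub>R \<zeta> s) \<in> borel_measurable lborel"
  proof -
    \<comment> \<open>Measurability of \<open>\<zeta>\<close> is known only on the open interval, so
      the endpoint values are split off as point terms; the case \<open>c = 0\<close> avoids
      counting one point twice.\<close>
    have eq: "indicator {0..\<sigma>} s *\<^sub>R \<zeta> s = indicator {0..\<sigma>} s * (indicator {0<..<c} s * \<zeta> s)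
        + indicator {0} s * (indicator {0..\<sigma>} 0 * (1 - indicator {0<..<c} 0) * \<zeta> 0)
        + (if c = 0 then 0 else indicator {c} s * (indicator {0..\<sigma>} c * \<zeta> c))" for s
      using assms(2) by (auto simp: indicator_def)
    show ?thesis unfolding eq by measurable
  qed
  ultimately show ?thesis
    unfolding set_lebesgue_integral_def by (intro integral_cong_AE) auto
qed

text \<open>Replacing \<open>\<theta>\<close> by \<open>G - \<i> * w\<close> leaves an equation in
  \<open>w\<close> alone, with a right-hand side entire in the unknown. Its complex solution
  \<open>T\<close> continues \<open>w\<close>, and \<open>G - \<i> * T\<close> continues
  \<open>\<theta>\<close>.\<close>

lemma real_analytic_on_trace:
  fixes \<theta> w :: "real \<Rightarrow> real" and G :: "complex \<Rightarrow> complex" and c :: real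
  assumes contG: "continuous_on {z. 0 \<le> Im z} G" and holG: "G holomorphic_on {z. 0 < Im z}"
    and G: "\<And>\<sigma>. \<sigma> \<in> {0<..<pi} \<Longrightarrow> G (of_real \<sigma>) = Complex (\<theta> \<sigma>) (w \<sigma>)"
    and ode: "\<And>\<sigma>. \<sigma> \<in> {0<..<pi} \<Longrightarrow>
      (w has_real_derivative c * (cos \<sigma> / sin \<sigma>) * sin (\<sigma> + \<theta> \<sigma>) * exp (- 3 * w \<sigma>)) (at \<sigma>)"
  shows "real_analytic_on w {0<..<pi} \<and> real_analytic_on \<theta> {0<..<pi}"
proof -
  have main: "\<exists>r>0. (\<exists>a. \<forall>y. \<bar>y - x\<bar> < r \<longrightarrow> (\<lambda>n. a n * (y - x) ^ n) sums w y) \<and>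
      (\<exists>a. \<forall>y. \<bar>y - x\<bar> < r \<longrightarrow> (\<lambda>n. a n * (y - x) ^ n) sums \<theta> y)" if x: "x \<in> {0<..<pi}" for x
  proof -
    define r0 where "r0 = min x (pi - x) / 2"
    have r0: "r0 > 0" "r0 < x" "r0 < pi - x"
    proof -
      have "r0 \<le> x / 2" "r0 \<le> (pi - x) / 2" "0 < r0" "0 < x" "x < pi" using x by (auto simp: r0_def)
      then show "0 < r0" "r0 < x" "r0 < pi - x" by (simp_all add: field_simps)
    qed
    let ?S = "cball (complex_of_real x) r0 \<inter> {z. 0 \<le> Im z}"
    define A where "A z = of_real c * (cos z / sin z)" for z :: complex
    define f where "f z u = A z * sin (z + G z - \<i> * u) * exp (- 3 * u)" for z u
    define f' where "f' z u = A z * (- \<i> * cos (z + G z - \<i> * u) - 3 * sin (z + G z - \<i> * u)) * exp (- 3 * u)" for z u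
    \<comment> \<open>The zeros of the complex sine are the multiples of pi, and the disc lies in
      the strip where the real part is strictly between 0 and pi.\<close>
    have sin0: "sin z \<noteq> 0" if "z \<in> cball (of_real x) r0" for z :: complex
    proof
      assume "sin z = 0"
      then obtain n :: int where n: "z = of_real (n * pi)" using sin_eq_0[of z] by blast
      have "\<bar>Re (of_real x - z)\<bar> \<le> r0"
        using that abs_Re_le_cmod[of "of_real x - z"] by (simp add: dist_norm)
      then have "\<bar>x - real_of_int n * pi\<bar> \<le> r0" by (simp add: n)
      then have "0 < real_of_int n * pi" "real_of_int n * pi < 1 * pi" using r0 by linarith+
      then have "0 < n" "n < 1" by (auto simp: zero_less_mult_iff)
      then show False by simp
    qed
    have contA: "continuous_on ?S A" unfolding A_def by (intro continuous_intros) (auto dest: sin0)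
    have cG: "continuous_on ?S G" by (rule continuous_on_subset[OF contG]) auto
    have contf: "continuous_on (?S \<times> UNIV) (\<lambda>(z, u). f z u)" "continuous_on (?S \<times> UNIV) (\<lambda>(z, u). f' z u)"
      unfolding f_def f'_def case_prod_unfold
      by (intro continuous_intros continuous_on_compose2[OF contA] continuous_on_compose2[OF cG]; auto)+
    obtain r T where r: "0 < r" "r \<le> r0"
      and T: "continuous_on (ball (of_real x) r \<inter> {z. 0 \<le> Im z}) T"
        "T holomorphic_on (ball (of_real x) r \<inter> {z. 0 < Im z})"
        "\<And>y. \<bar>y - x\<bar> < r \<Longrightarrow> T (of_real y) = of_real (w y)"
    proof (rule ODE_solution_extends_to_half_disc[OF r0(1) contf, where u = w])
      show "(f z has_field_derivative f' z u) (at u)" for z u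
        unfolding f_def f'_def by (auto intro!: derivative_eq_intros simp: algebra_simps)
      show "(\<lambda>z. f z (g z)) holomorphic_on U"
        if "U \<subseteq> ball (of_real x) r0 \<inter> {z. 0 < Im z}" "g holomorphic_on U" for g U
        unfolding f_def A_def using that sin0
        by (intro holomorphic_intros holomorphic_on_subset[OF holG]) (auto dest: sin0)
      show "\<exists>D. (w has_real_derivative D) (at y) \<and> of_real D = f (of_real y) (of_real (w y))"
        if "\<bar>y - x\<bar> \<le> r0" for y
      proof -
        have y: "y \<in> {0<..<pi}" using that r0 by (auto simp: abs_le_iff)
        have e: "of_real y + G (of_real y) - \<i> * of_real (w y) = of_real (y + \<theta> y)"
          using G[OF y] by (simp add: complex_eq_iff)
        have "f (of_real y) (of_real (w y)) = of_real (c * (cos y / sin y) * sin (y + \<theta> y) * exp (- 3 * w y))"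
          unfolding f_def A_def e by (simp flip: sin_of_real cos_of_real exp_of_real)
        then show ?thesis using ode[OF y] by metis
      qed
    qed blast
    have "\<exists>a. \<forall>y. \<bar>y - x\<bar> < r \<longrightarrow> (\<lambda>n. a n * (y - x) ^ n) sums w y"
      by (rule real_power_series_by_reflection[OF T])
    moreover have "\<exists>a. \<forall>y. \<bar>y - x\<bar> < r \<longrightarrow> (\<lambda>n. a n * (y - x) ^ n) sums \<theta> y"
    proof (rule real_power_series_by_reflection[where f = "\<lambda>z. G z - \<i> * T z"])
      show "continuous_on (ball (of_real x) r \<inter> {z. 0 \<le> Im z}) (\<lambda>z. G z - \<i> * T z)"
        by (intro continuous_intros T continuous_on_subset[OF contG]) auto
      show "(\<lambda>z. G z - \<i> * T z) holomorphic_on (ball (of_real x) r \<inter> {z. 0 < Im z})"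
        by (intro holomorphic_intros T holomorphic_on_subset[OF holG]) auto
      show "G (of_real y) - \<i> * T (of_real y) = of_real (\<theta> y)" if y: "\<bar>y - x\<bar> < r" for y
      proof -
        have "y \<in> {0<..<pi}" using y r r0 by (auto simp: abs_less_iff)
        then show ?thesis using T(3)[OF y] G by (simp add: complex_eq_iff)
      qed
    qed
    ultimately show ?thesis using r by blast
  qed
  show ?thesis unfolding real_analytic_on_def using main by blast
qed

lemma real_analytic_on_add_const:
  assumes "real_analytic_on f U"
  shows "real_analytic_on (\<lambda>x. f x + k) U"
  unfolding real_analytic_on_def
proof
  fix x assume "x \<in> U"
  then obtain r a where r: "r > 0" and a: "\<And>y. \<bar>y - x\<bar> < r \<Longrightarrow> (\<lambda>n. a n * (y - x) ^ n) sums f y"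
    using assms unfolding real_analytic_on_def by blast
  define b where "b n = a n + (if n = 0 then k else 0)" for n
  have "(\<lambda>n. b n * (y - x) ^ n) sums (f y + k)" if "\<bar>y - x\<bar> < r" for y
  proof -
    have "(\<lambda>n. a n * (y - x) ^ n + (if n = 0 then k else 0)) sums (f y + k)"
      by (intro sums_add a that sums_single)
    moreover have "a n * (y - x) ^ n + (if n = 0 then k else 0) = b n * (y - x) ^ n" for n
      by (simp add: b_def)
    ultimately show ?thesis by simp
  qed
  with r show "\<exists>r>0. \<exists>a. \<forall>y. \<bar>y - x\<bar> < r \<longrightarrow> (\<lambda>n. a n * (y - x) ^ n) sums (f y + k)" by blast
qed

theorem theorem4p5:
  fixes \<alpha> :: real and \<zeta> :: "real \<Rightarrow> real"
    and \<tau> \<theta> \<tau>e \<theta>e :: "real \<Rightarrow> real"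
  assumes alpha: "\<alpha> \<ge> 2 / pi * (1 + 1 / (3 * sqrt pi))"
    and meas: "set_borel_measurable lborel {0<..<pi/2} \<zeta>"
    and L2: "set_integrable lborel {0<..<pi/2} (\<lambda>s. (\<zeta> s)\<^sup>2)"
    and nonneg: "AE s in lborel. s \<in> {0<..<pi/2} \<longrightarrow> \<zeta> s \<ge> 0"
    and fixpt: "AE s in lborel. s \<in> {0<..<pi/2} \<longrightarrow> \<zeta> s = opPhi \<alpha> \<zeta> s"
    and norm_bd: "sqrt (LINT s:{0<..<pi/2}|lborel. (\<zeta> s)\<^sup>2) \<le> 9 * sqrt pi / 2"
    and range: "\<And>\<sigma>. \<sigma> \<in> {0..pi/2} \<Longrightarrow>
                  0 \<le> \<sigma> + (1/3) * opH \<zeta> \<sigma> \<and> \<sigma> + (1/3) * opH \<zeta> \<sigma> \<le> pi"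
    and theta_def: "\<And>\<sigma>. \<theta> \<sigma> = (1/3) * opH \<zeta> \<sigma>"
    and tau_def: "\<And>\<sigma>. \<tau> \<sigma> = ln (pi/2) + (1/3) * (LINT s:{0..\<sigma>}|lborel. \<zeta> s)"
    and tau_ext: "\<And>\<sigma>. \<tau>e \<sigma> = (if \<sigma> \<le> pi/2 then \<tau> \<sigma> else \<tau> (pi - \<sigma>))"
    and theta_ext: "\<And>\<sigma>. \<theta>e \<sigma> = (if \<sigma> \<le> pi/2 then \<theta> \<sigma> else - \<theta> (pi - \<sigma>))"
  shows "real_analytic_on \<tau>e {0<..<pi} \<and> real_analytic_on \<theta>e {0<..<pi}"
proof -
  define f where "f s = indicator {0<..<pi/2} s * \<zeta> s" for s
  note \<zeta>_meas = meas
  interpret L2_density f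
  proof
    show "f \<in> borel_measurable borel"
      using meas by (simp add: set_borel_measurable_def f_def[abs_def])
    have "indicator {0<..<pi/2} s *\<^sub>R (\<zeta> s)\<^sup>2 = (f s)\<^sup>2" for s
      by (simp add: f_def indicator_def)
    then show "integrable lborel (\<lambda>s. (f s)\<^sup>2)"
      using L2 by (simp add: set_integrable_def)
  qed (simp add: f_def)
  have H: "opH \<zeta> \<sigma> = (\<integral>s. kerK s \<sigma> * f s \<partial>lborel) / pi" for \<sigma>
    unfolding opH_def set_lebesgue_integral_def f_def by (simp add: mult_ac)
  define W where "W \<sigma> = (\<integral>s. indicator {0..\<sigma>} s * f s \<partial>lborel)" for \<sigma>
  have W: "(LINT s:{0..\<sigma>}|lborel. \<zeta> s) = W \<sigma>" if "\<sigma> \<le> pi/2" for \<sigma>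
    unfolding W_def f_def by (rule set_integral_atLeastAtMost_eq_cut_off[OF \<zeta>_meas that])
  \<comment> \<open>Removing the constant makes \<open>w\<close> the imaginary part of the trace of
    \<open>half_plane_fun\<close>.\<close>
  define w where "w \<sigma> = \<tau>e \<sigma> - ln (pi/2)" for \<sigma>
  have wW: "w \<sigma> = W \<sigma> / 3" if "\<sigma> \<le> pi/2" for \<sigma>
    using W[OF that] that by (simp add: w_def tau_ext tau_def)
  have w_even: "w (pi - \<sigma>) = w \<sigma>" for \<sigma>
  proof (cases "\<sigma> = pi/2")
    case True
    then have "pi - \<sigma> = \<sigma>" by simp
    then show ?thesis by (simp only:)
  qed (auto simp: w_def tau_ext)
  have \<theta>_odd: "\<theta>e (pi - \<sigma>) = - \<theta>e \<sigma>" for \<sigma>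
  proof (cases "\<sigma> = pi/2")
    case True
    have e: "pi - \<sigma> = pi/2" using True by simp
    \<comment> \<open>The quotient of sines is -1 here, or 0/0 = 0 when \<open>cos s = 0\<close>,
      and \<open>ln 0 = 0\<close>. So \<open>\<theta>\<close> vanishes at pi/2, as oddness demands
      at the centre.\<close>
    have "kerK s (pi/2) = 0" for s
      by (cases "cos s = 0") (auto simp: kerK_def sin_add sin_diff)
    then have "\<theta>e (pi/2) = 0" by (simp add: theta_ext theta_def H)
    then show ?thesis unfolding e True by simp
  qed (auto simp: theta_ext)
  have G: "half_plane_fun (of_real \<sigma>) = Complex (\<theta>e \<sigma>) (w \<sigma>)" if \<sigma>: "\<sigma> \<in> {0<..<pi}" for \<sigma>
  proof -
    have left: "half_plane_fun (of_real \<sigma>) = Complex (\<theta>e \<sigma>) (w \<sigma>)" if "0 < \<sigma>" "\<sigma> \<le> pi/2" for \<sigma>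
      using half_plane_fun_of_real[OF that] wW[OF that(2)] that(2)
      by (simp add: W_def theta_ext theta_def H)
    show ?thesis
    proof (cases "\<sigma> \<le> pi/2")
      case False
      have "half_plane_fun (of_real \<sigma>) = - cnj (half_plane_fun (of_real (pi - \<sigma>)))"
        using half_plane_fun_reflect[of "pi - \<sigma>"] by simp
      also have "\<dots> = Complex (\<theta>e \<sigma>) (w \<sigma>)"
        using left[of "pi - \<sigma>"] False \<sigma> by (simp add: w_even \<theta>_odd complex_eq_iff)
      finally show ?thesis .
    qed (use \<sigma> left in auto)
  qed
  \<comment> \<open>The factor 3 of the operator cancels against the 1/3 in
    \<open>w = W / 3\<close>; likewise \<open>exp (W \<sigma>)\<close> is
    \<open>exp (3 * w \<sigma>)\<close>, so the fixed point equation reads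
    \<open>f = 3 * \<phi>\<close> almost everywhere.\<close>
  define c where "c = 1 / (\<alpha> * pi)"
  define \<phi> where "\<phi> \<sigma> = c * (cos \<sigma> / sin \<sigma>) * sin (\<sigma> + \<theta>e \<sigma>) * exp (- 3 * w \<sigma>)" for \<sigma>
  have contG: "continuous_on {0<..<pi} (\<lambda>\<sigma>. half_plane_fun (of_real \<sigma>))"
    by (intro continuous_on_compose2[OF continuous_on_half_plane_fun] continuous_intros) auto
  have cont: "continuous_on {0<..<pi} \<theta>e" "continuous_on {0<..<pi} w"
    by (rule continuous_on_eq[OF continuous_on_Re[OF contG]], simp add: G)
       (rule continuous_on_eq[OF continuous_on_Im[OF contG]], simp add: G)
  have \<phi>_eq: "AE s in lborel. s \<in> {0<..<pi/2} \<longrightarrow> f s = 3 * \<phi> s"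
    using fixpt
  proof eventually_elim
    fix s assume s: "s \<in> {0<..<pi/2} \<longrightarrow> \<zeta> s = opPhi \<alpha> \<zeta> s"
    show "s \<in> {0<..<pi/2} \<longrightarrow> f s = 3 * \<phi> s"
    proof
      assume I: "s \<in> {0<..<pi/2}"
      have "f s = opPhi \<alpha> \<zeta> s" using s I by (simp add: f_def)
      also have "\<dots> = 3 * \<phi> s"
      proof -
        have s2: "s \<le> pi/2" using I by simp
        have 1: "\<theta>e s = (1/3) * opH \<zeta> s" using s2 by (simp add: theta_ext theta_def)
        have 2: "exp (- 3 * w s) = inverse (exp (W s))" using wW[OF s2] by (simp add: exp_minus)
        show ?thesis unfolding opPhi_def \<phi>_def c_def W[OF s2] 1 2 cot_def by (simp only: divide_inverse mult_1_left mult_ac)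
      qed
      finally show "f s = 3 * \<phi> s" .
    qed
  qed
  \<comment> \<open>The fixed point equation holds only almost everywhere on (0, pi/2), but
    \<open>\<phi>\<close> is continuous on (0, pi) and odd about pi/2, so \<open>w\<close> as a
    reflected primitive is differentiable everywhere there.\<close>
  have ode: "(w has_real_derivative \<phi> \<sigma>) (at \<sigma>)" if \<sigma>: "\<sigma> \<in> {0<..<pi}" for \<sigma>
  proof (rule reflected_primitive_has_derivative[where c = "pi/2"])
    have "sin \<sigma> \<noteq> 0" if "0 < \<sigma>" "\<sigma> < pi" for \<sigma> using sin_gt_zero[OF that] by simp
    then show c\<phi>: "continuous_on {0<..<2 * (pi/2)} \<phi>"
      unfolding \<phi>_def by (auto intro!: continuous_intros cont)
    show "\<phi> (2 * (pi/2) - x) = - \<phi> x" for x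
    proof -
      have "sin (pi - x + - \<theta>e x) = sin (x + \<theta>e x)"
        using sin_pi_minus[of "x + \<theta>e x"] by (simp add: algebra_simps)
      moreover have "cos (pi - x) / sin (pi - x) = - (cos x / sin x)" by simp
      ultimately show ?thesis by (simp add: \<phi>_def w_even \<theta>_odd)
    qed
    show "w (2 * (pi/2) - x) = w x" for x by (simp add: w_even)
    show "w (pi/2) - w a = (\<integral>s. \<phi> s * indicator {a..pi/2} s \<partial>lborel)" if a: "0 < a" "a \<le> pi/2" for a
    proof -
      have i: "integrable lborel (\<lambda>s. indicator {0..b} s * f s)" for b
        by (rule integrable_bounded_mult[where B = 1]) auto
      \<comment> \<open>The difference of the indicators misses the point \<open>a\<close>, and
        \<open>f\<close> vanishes at pi/2; both points are discarded as null sets.\<close>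
      have "W (pi/2) - W a = (\<integral>s. indicator {0..pi/2} s * f s - indicator {0..a} s * f s \<partial>lborel)"
        unfolding W_def using i by simp
      also have "\<dots> = (\<integral>s. 3 * (\<phi> s * indicator {a..pi/2} s) \<partial>lborel)"
      proof (rule integral_cong_AE)
        have "continuous_on {a..pi/2} \<phi>"
          by (rule continuous_on_subset[OF c\<phi>]) (use a in auto)
        then show "(\<lambda>s. 3 * (\<phi> s * indicator {a..pi/2} s)) \<in> borel_measurable lborel"
          using borel_measurable_continuous_on_indicator[of "{a..pi/2}" \<phi>]
          by (simp add: mult.commute[of "indicator _ _"])
        show "AE s in lborel. indicator {0..pi/2} s * f s - indicator {0..a} s * f s = 3 * (\<phi> s * indicator {a..pi/2} s)"
          using \<phi>_eq AE_lborel_singleton[of a] AE_lborel_singleton[of "pi/2"]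
        proof eventually_elim
          case (elim s)
          then show ?case using a supp[of s] by (auto simp: indicator_def)
        qed
      qed measurable
      also have "\<dots> = 3 * (\<integral>s. \<phi> s * indicator {a..pi/2} s \<partial>lborel)" by simp
      finally show ?thesis using a by (simp add: wW)
    qed
  qed (use \<sigma> in auto)
  have "real_analytic_on w {0<..<pi} \<and> real_analytic_on \<theta>e {0<..<pi}"
    using real_analytic_on_trace[OF continuous_on_half_plane_fun holomorphic_on_half_plane_fun G, of c] ode
    unfolding \<phi>_def by blast
  moreover have "(\<lambda>x. w x + ln (pi/2)) = \<tau>e" by (simp add: w_def)
  ultimately show ?thesis using real_analytic_on_add_const[of w _ "ln (pi/2)"] by metis
qed

end
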